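(* There exist a $\mathrm{II}_1$ factor $\mathcal{M}$ and an automorphism $\theta$ of $\mathcal{M}$ such that $\theta$ is locally inner (for every $x \in \mathcal{M}$ there is a unitary $u_x \in \mathcal{M}$ with $\theta(x) = u_x x u_x^*$) but $\theta$ is not inner (there is no unitary $u \in \mathcal{M}$ with $\theta(x) = u x u^*$ for all $x \in \mathcal{M}$).
   Context: Automorphisms are *-automorphisms. An automorphism $\theta$ of a unital $C^*$-algebra $\mathfrak{A}$ is called locally inner if for every $x \in \mathfrak{A}$ there is a unitary $u_x \in \mathfrak{A}$ such that $\theta(x) = u_x x u_x^*$. The $\mathrm{II}_1$ factor is not required to have separable predual. *)

theory Defs
  imports "HOL-Analysis.Analysis"
begin

section \<open>Complex Hilbert spaces\<close>

class scaleC =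
  fixes scaleC :: "complex \<Rightarrow> 'a \<Rightarrow> 'a"  (infixr "*\<^sub>C" 75)

text \<open>
  A complex Hilbert space is also a real one; the real structure supplies the norm and the
  topology.  The inner product is linear in the first variable.
\<close>

class chilbert_space = real_inner + complete_space + scaleC +
  fixes cinner :: "'a \<Rightarrow> 'a \<Rightarrow> complex"
  assumes scaleR_scaleC: "r *\<^sub>R x = complex_of_real r *\<^sub>C x"
    and scaleC_add_right: "a *\<^sub>C (x + y) = a *\<^sub>C x + a *\<^sub>C y"
    and scaleC_add_left: "(a + b) *\<^sub>C x = a *\<^sub>C x + b *\<^sub>C x"
    and scaleC_scaleC: "a *\<^sub>C (b *\<^sub>C x) = (a * b) *\<^sub>C x"
    and cinner_commute: "cinner x y = cnj (cinner y x)"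
    and cinner_add_left: "cinner (x + y) z = cinner x z + cinner y z"
    and cinner_scaleC_left: "cinner (a *\<^sub>C x) y = a * cinner x y"
    and inner_eq_Re_cinner: "inner x y = Re (cinner x y)"

context chilbert_space
begin

lemma cinner_scaleC_right: "cinner x (a *\<^sub>C y) = cnj a * cinner x y"
  by (metis cinner_commute cinner_scaleC_left complex_cnj_mult)

lemma inner_scaleC_left: "inner (a *\<^sub>C x) y = inner x (cnj a *\<^sub>C y)"
  by (simp add: inner_eq_Re_cinner cinner_scaleC_left cinner_scaleC_right)

lemma cinner_eq_inner: "cinner x y = Complex (inner x y) (inner x (\<i> *\<^sub>C y))"
  by (simp add: inner_eq_Re_cinner cinner_scaleC_right complex_eq_iff)

lemma norm_scaleC: "norm (a *\<^sub>C x) = cmod a * norm x"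
proof -
  have "inner (a *\<^sub>C x) (a *\<^sub>C x) = inner x ((cnj a * a) *\<^sub>C x)"
    by (simp add: inner_scaleC_left scaleC_scaleC)
  also have "cnj a * a = complex_of_real ((cmod a)\<^sup>2)"
    by (metis complex_norm_square mult.commute)
  also have "inner x (complex_of_real ((cmod a)\<^sup>2) *\<^sub>C x) = (cmod a)\<^sup>2 * inner x x"
    by (simp only: scaleR_scaleC[symmetric] inner_scaleR_right)
  finally show ?thesis
    by (simp add: norm_eq_sqrt_inner real_sqrt_mult)
qed

end

lemma bounded_linear_scaleC: "bounded_linear (\<lambda>x::'a::chilbert_space. a *\<^sub>C x)"
proof (rule bounded_linear_intro[where K = "cmod a"])
  show "a *\<^sub>C (r *\<^sub>R x) = r *\<^sub>R (a *\<^sub>C x)" for r and x :: 'a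
    by (simp add: scaleR_scaleC scaleC_scaleC mult.commute)
qed (simp_all add: scaleC_add_right norm_scaleC mult.commute)

instantiation blinfun :: (real_normed_vector, chilbert_space) scaleC
begin

lift_definition scaleC_blinfun :: "complex \<Rightarrow> 'a \<Rightarrow>\<^sub>L 'b \<Rightarrow> 'a \<Rightarrow>\<^sub>L 'b"
  is "\<lambda>a A x. a *\<^sub>C A x"
  by (rule bounded_linear_compose[OF bounded_linear_scaleC])

instance ..

end


section \<open>The Hilbert space of square-summable families\<close>

typedef 'i ell2 = "{f :: 'i \<Rightarrow> complex. (\<lambda>i. (cmod (f i))\<^sup>2) summable_on UNIV}"
  morphisms ell2_nth Abs_ell2
  by (rule exI[of _ "\<lambda>_. 0"]) simp

setup_lifting type_definition_ell2

lemma square_summable_mult: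
  assumes "(\<lambda>i. (cmod (f i))\<^sup>2) summable_on UNIV" "(\<lambda>i. (cmod (g i))\<^sup>2) summable_on UNIV"
  shows "(\<lambda>i::'i. f i * cnj (g i)) summable_on UNIV"
proof -
  have "(\<lambda>i. norm (f i * cnj (g i))) summable_on UNIV"
    by (rule abs_summable_product)
      (use assms in \<open>simp_all add: norm_mult power2_eq_square\<close>)
  then show ?thesis by (rule abs_summable_summable)
qed

lemma square_summable_add:
  assumes "(\<lambda>i. (cmod (f i))\<^sup>2) summable_on UNIV" "(\<lambda>i. (cmod (g i))\<^sup>2) summable_on UNIV"
  shows "(\<lambda>i::'i. (cmod (f i + g i))\<^sup>2) summable_on UNIV"
proof (rule summable_on_comparison_test)
  show "(\<lambda>i. 2 * (cmod (f i))\<^sup>2 + 2 * (cmod (g i))\<^sup>2) summable_on UNIV"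
    by (intro summable_on_add summable_on_cmult_right assms)
  show "(cmod (f i + g i))\<^sup>2 \<le> 2 * (cmod (f i))\<^sup>2 + 2 * (cmod (g i))\<^sup>2" for i
  proof -
    have "(cmod (f i + g i))\<^sup>2 \<le> (cmod (f i) + cmod (g i))\<^sup>2"
      by (intro power_mono norm_triangle_ineq) simp
    also have "\<dots> \<le> 2 * (cmod (f i))\<^sup>2 + 2 * (cmod (g i))\<^sup>2"
      using sum_squares_bound[of "cmod (f i)" "cmod (g i)"] by (simp add: power2_sum)
    finally show ?thesis .
  qed
qed simp

lemma square_summable_scale:
  assumes "(\<lambda>i. (cmod (f i))\<^sup>2) summable_on UNIV"
  shows "(\<lambda>i::'i. (cmod (a * f i))\<^sup>2) summable_on UNIV"
  using summable_on_cmult_right[OF assms, of "(cmod a)\<^sup>2"]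
  by (simp add: norm_mult power_mult_distrib)

instantiation ell2 :: (type) real_inner
begin

lift_definition zero_ell2 :: "'a ell2" is "\<lambda>_. 0" by simp

lift_definition plus_ell2 :: "'a ell2 \<Rightarrow> 'a ell2 \<Rightarrow> 'a ell2" is "\<lambda>f g i. f i + g i"
  by (simp add: square_summable_add)

lift_definition uminus_ell2 :: "'a ell2 \<Rightarrow> 'a ell2" is "\<lambda>f i. - f i"
  by simp

lift_definition minus_ell2 :: "'a ell2 \<Rightarrow> 'a ell2 \<Rightarrow> 'a ell2" is "\<lambda>f g i. f i - g i"
  subgoal for f g using square_summable_add[of f "\<lambda>i. - g i"] by simp
  done

lift_definition scaleR_ell2 :: "real \<Rightarrow> 'a ell2 \<Rightarrow> 'a ell2" is "\<lambda>r f i. complex_of_real r * f i"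
  by (simp add: square_summable_scale del: norm_mult)

definition inner_ell2 :: "'a ell2 \<Rightarrow> 'a ell2 \<Rightarrow> real" where
  "inner_ell2 x y = Re (\<Sum>\<^sub>\<infinity>i. ell2_nth x i * cnj (ell2_nth y i))"

definition norm_ell2 :: "'a ell2 \<Rightarrow> real" where
  "norm_ell2 x = sqrt (inner x x)"

definition sgn_ell2 :: "'a ell2 \<Rightarrow> 'a ell2" where
  "sgn_ell2 x = inverse (norm x) *\<^sub>R x"

definition dist_ell2 :: "'a ell2 \<Rightarrow> 'a ell2 \<Rightarrow> real" where
  "dist_ell2 x y = norm (x - y)"

definition uniformity_ell2 :: "('a ell2 \<times> 'a ell2) filter" where
  "uniformity_ell2 = (INF e\<in>{0<..}. principal {(x, y). dist x y < e})"

definition open_ell2 :: "'a ell2 set \<Rightarrow> bool" where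
  "open_ell2 U = (\<forall>x\<in>U. eventually (\<lambda>(x', y). x' = x \<longrightarrow> y \<in> U) uniformity)"

lemma square_summable_ell2: "(\<lambda>i. (cmod (ell2_nth x i))\<^sup>2) summable_on UNIV"
  using ell2_nth[of x] by simp

lemma summable_ell2_mult: "(\<lambda>i. ell2_nth x i * cnj (ell2_nth y i)) summable_on UNIV"
  by (intro square_summable_mult square_summable_ell2)

lemma inner_ell2_self: "inner x x = (\<Sum>\<^sub>\<infinity>i. (cmod (ell2_nth (x::'a ell2) i))\<^sup>2)"
  unfolding inner_ell2_def infsum_Re[OF summable_ell2_mult, symmetric]
  by (intro infsum_cong) (simp flip: complex_norm_square)

instance
proof
  fix x y z :: "'a ell2" and r s :: real
  show "x + y + z = x + (y + z)" "x + y = y + x" "0 + x = x" "- x + x = 0" "x - y = x + - y"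
    "r *\<^sub>R (x + y) = r *\<^sub>R x + r *\<^sub>R y" "(r + s) *\<^sub>R x = r *\<^sub>R x + s *\<^sub>R x"
    "r *\<^sub>R (s *\<^sub>R x) = (r * s) *\<^sub>R x" "1 *\<^sub>R x = x"
    by (transfer; simp add: fun_eq_iff algebra_simps)+
  show "dist x y = norm (x - y)" by (rule dist_ell2_def)
  show "sgn x = inverse (norm x) *\<^sub>R x" by (rule sgn_ell2_def)
  show "uniformity = (INF e\<in>{0<..}. principal {(x::'a ell2, y). dist x y < e})"
    by (rule uniformity_ell2_def)
  show "open U = (\<forall>x\<in>U. \<forall>\<^sub>F (x', y) in uniformity. x' = x \<longrightarrow> y \<in> U)" for U :: "'a ell2 set"
    by (rule open_ell2_def)
  show "norm x = sqrt (inner x x)" by (rule norm_ell2_def)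
  show "inner x y = inner y x"
  proof -
    have "(\<Sum>\<^sub>\<infinity>i. ell2_nth x i * cnj (ell2_nth y i)) =
        cnj (\<Sum>\<^sub>\<infinity>i. ell2_nth y i * cnj (ell2_nth x i))"
      by (simp add: mult.commute flip: infsum_cnj)
    then show ?thesis by (simp add: inner_ell2_def)
  qed
  show "inner (x + y) z = inner x z + inner y z"
    by (simp add: inner_ell2_def plus_ell2.rep_eq distrib_right infsum_add summable_ell2_mult)
  show "inner (r *\<^sub>R x) y = r * inner x y"
    by (simp add: inner_ell2_def scaleR_ell2.rep_eq mult.assoc infsum_cmult_right')
  show "0 \<le> inner x x"
    unfolding inner_ell2_self by (intro infsum_nonneg) simp
  show "inner x x = 0 \<longleftrightarrow> x = 0"
  proof
    assume "inner x x = 0"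
    then have "(cmod (ell2_nth x i))\<^sup>2 = 0" for i
      unfolding inner_ell2_self
      by (intro nonneg_infsum_le_0D[OF _ square_summable_ell2]) auto
    then show "x = 0"
      by (simp add: zero_ell2.rep_eq fun_eq_iff flip: ell2_nth_inject)
  qed (simp add: inner_ell2_self zero_ell2.rep_eq)
qed

end

lemma norm_ell2_sq: "(norm x)\<^sup>2 = (\<Sum>\<^sub>\<infinity>i. (cmod (ell2_nth x i))\<^sup>2)"
  by (simp add: power2_norm_eq_inner inner_ell2_self)

lemma sum_le_norm_ell2_sq:
  assumes "finite F"
  shows "(\<Sum>i\<in>F. (cmod (ell2_nth x i))\<^sup>2) \<le> (norm x)\<^sup>2"
  unfolding norm_ell2_sq
  by (rule finite_sum_le_infsum) (use assms square_summable_ell2 in auto)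

lemma cmod_ell2_nth_le: "cmod (ell2_nth x i) \<le> norm x"
  using sum_le_norm_ell2_sq[of "{i}" x] by (simp add: power2_le_iff_abs_le)

instance ell2 :: (type) complete_space
proof
  fix X :: "nat \<Rightarrow> 'a ell2"
  assume X: "Cauchy X"
  have "Cauchy (\<lambda>n. ell2_nth (X n) i)" for i
  proof (rule CauchyI)
    fix e :: real assume "e > 0"
    then obtain N where N: "\<And>m n. m \<ge> N \<Longrightarrow> n \<ge> N \<Longrightarrow> norm (X m - X n) < e"
      using X by (meson CauchyD)
    show "\<exists>N. \<forall>m\<ge>N. \<forall>n\<ge>N. cmod (ell2_nth (X m) i - ell2_nth (X n) i) < e"
      by (metis N cmod_ell2_nth_le le_less_trans minus_ell2.rep_eq)
  qed
  then have "\<exists>l. (\<lambda>n. ell2_nth (X n) i) \<longlonglongrightarrow> l" for i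
    by (simp add: Cauchy_convergent_iff convergent_def)
  then obtain f where f: "\<And>i. (\<lambda>n. ell2_nth (X n) i) \<longlonglongrightarrow> f i"
    by metis
  have bound: "(\<Sum>i\<in>F. (cmod (ell2_nth (X n) i - f i))\<^sup>2) \<le> e\<^sup>2"
    if N: "\<And>m n. m \<ge> N \<Longrightarrow> n \<ge> N \<Longrightarrow> norm (X m - X n) < e" and "n \<ge> N" and F: "finite F"
    for e N n F
  proof (rule LIMSEQ_le_const2)
    show "(\<lambda>m. \<Sum>i\<in>F. (cmod (ell2_nth (X n) i - ell2_nth (X m) i))\<^sup>2)
        \<longlonglongrightarrow> (\<Sum>i\<in>F. (cmod (ell2_nth (X n) i - f i))\<^sup>2)"
      by (intro tendsto_intros f)
    have "(\<Sum>i\<in>F. (cmod (ell2_nth (X n) i - ell2_nth (X m) i))\<^sup>2) \<le> e\<^sup>2" if "m \<ge> N" for m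
    proof -
      have "(\<Sum>i\<in>F. (cmod (ell2_nth (X n) i - ell2_nth (X m) i))\<^sup>2) \<le> (norm (X n - X m))\<^sup>2"
        using sum_le_norm_ell2_sq[OF F, of "X n - X m"] by (simp add: minus_ell2.rep_eq)
      also have "\<dots> \<le> e\<^sup>2"
        using N[OF \<open>n \<ge> N\<close> that] by (intro power_mono) auto
      finally show ?thesis .
    qed
    then show "\<exists>N. \<forall>m\<ge>N. (\<Sum>i\<in>F. (cmod (ell2_nth (X n) i - ell2_nth (X m) i))\<^sup>2) \<le> e\<^sup>2"
      by blast
  qed
  have diff: "(\<lambda>i. (cmod (ell2_nth (X n) i - f i))\<^sup>2) summable_on UNIV"
    if N: "\<And>m n. m \<ge> N \<Longrightarrow> n \<ge> N \<Longrightarrow> norm (X m - X n) < e" and "n \<ge> N" for e N n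
    by (rule nonneg_bdd_above_summable_on)
      (use bound[OF N \<open>n \<ge> N\<close>] in \<open>auto intro!: bdd_aboveI[of _ "e\<^sup>2"]\<close>)
  obtain N1 where N1: "\<And>m n. m \<ge> N1 \<Longrightarrow> n \<ge> N1 \<Longrightarrow> norm (X m - X n) < 1"
    using X by (meson CauchyD zero_less_one)
  have "(\<lambda>i. (cmod (f i))\<^sup>2) summable_on UNIV"
    using square_summable_add[OF square_summable_ell2[of "X N1"],
        of "\<lambda>i. - (ell2_nth (X N1) i - f i)"] diff[OF N1, of N1]
    by (simp add: norm_minus_commute)
  then have L: "ell2_nth (Abs_ell2 f) = f"
    by (simp add: Abs_ell2_inverse)
  have "X \<longlonglongrightarrow> Abs_ell2 f"
  proof (rule LIMSEQ_I)
    fix e :: real assume e: "e > 0"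
    obtain N where N: "\<And>m n. m \<ge> N \<Longrightarrow> n \<ge> N \<Longrightarrow> norm (X m - X n) < e / 2"
      using X e by (metis CauchyD half_gt_zero)
    have "norm (X n - Abs_ell2 f) < e" if "n \<ge> N" for n
    proof -
      have "(norm (X n - Abs_ell2 f))\<^sup>2 \<le> (e / 2)\<^sup>2"
        unfolding norm_ell2_sq minus_ell2.rep_eq L
        by (rule infsum_le_finite_sums[OF diff[OF N that] bound[OF N that]])
      then have "norm (X n - Abs_ell2 f) \<le> e / 2"
        using e by (simp add: power2_le_iff_abs_le)
      then show ?thesis using e by simp
    qed
    then show "\<exists>N. \<forall>n\<ge>N. norm (X n - Abs_ell2 f) < e" by blast
  qed
  then show "convergent X" by (rule convergentI)
qed

instantiation ell2 :: (type) chilbert_space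
begin

lift_definition scaleC_ell2 :: "complex \<Rightarrow> 'a ell2 \<Rightarrow> 'a ell2" is "\<lambda>a f i. a * f i"
  by (simp add: square_summable_scale del: norm_mult)

definition cinner_ell2 :: "'a ell2 \<Rightarrow> 'a ell2 \<Rightarrow> complex" where
  "cinner_ell2 x y = (\<Sum>\<^sub>\<infinity>i. ell2_nth x i * cnj (ell2_nth y i))"

instance
proof
  fix x y z :: "'a ell2" and a b :: complex and r :: real
  show "r *\<^sub>R x = complex_of_real r *\<^sub>C x" "a *\<^sub>C (x + y) = a *\<^sub>C x + a *\<^sub>C y"
    "(a + b) *\<^sub>C x = a *\<^sub>C x + b *\<^sub>C x" "a *\<^sub>C (b *\<^sub>C x) = (a * b) *\<^sub>C x"
    by (transfer; simp add: fun_eq_iff algebra_simps)+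
  show "cinner x y = cnj (cinner y x)"
    by (simp add: cinner_ell2_def mult.commute flip: infsum_cnj)
  show "cinner (x + y) z = cinner x z + cinner y z"
    by (simp add: cinner_ell2_def plus_ell2.rep_eq distrib_right infsum_add summable_ell2_mult)
  show "cinner (a *\<^sub>C x) y = a * cinner x y"
    by (simp add: cinner_ell2_def scaleC_ell2.rep_eq mult.assoc infsum_cmult_right')
  show "inner x y = Re (cinner x y)"
    by (simp add: cinner_ell2_def inner_ell2_def)
qed

end


section \<open>Bounded operators and adjoints\<close>

text \<open>
  The library type of bounded linear maps consists of real-linear maps; the bounded operators
  of a complex Hilbert space are the complex-linear ones among them.
\<close>

definition bounded_operators :: "('h::chilbert_space \<Rightarrow>\<^sub>L 'h) set" where
  "bounded_operators = {A :: 'h \<Rightarrow>\<^sub>L 'h. \<forall>a x. A (a *\<^sub>C x) = a *\<^sub>C A x}"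

definition is_adjoint :: "('h::chilbert_space \<Rightarrow>\<^sub>L 'h) \<Rightarrow> ('h \<Rightarrow>\<^sub>L 'h) \<Rightarrow> bool" where
  "is_adjoint A B \<longleftrightarrow> (\<forall>x y. cinner (A x) y = cinner x (B y))"

definition adj :: "('h::chilbert_space \<Rightarrow>\<^sub>L 'h) \<Rightarrow> ('h \<Rightarrow>\<^sub>L 'h)" where
  "adj A = (THE B. is_adjoint A B)"

lemma is_adjoint_unique:
  assumes "is_adjoint A B" "is_adjoint A C"
  shows "B = C"
proof (rule blinfun_eqI)
  fix y
  have "inner x (B y) = inner x (C y)" for x
    using assms by (metis is_adjoint_def inner_eq_Re_cinner)
  then show "B y = C y"
    by (metis vector_eq_ldot)
qed

lemma adjI: "is_adjoint A B \<Longrightarrow> adj A = B"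
  unfolding adj_def by (blast intro: is_adjoint_unique)

lemma riesz_representation:
  fixes f :: "'a::{real_inner,complete_space} \<Rightarrow> real"
  assumes "bounded_linear f"
  shows "\<exists>z. \<forall>x. f x = inner z x"
proof -
  interpret f: bounded_linear f by fact
  define q where "q x = (norm x)\<^sup>2 - 2 * f x" for x
  obtain K where K: "\<And>x. norm (f x) \<le> norm x * K"
    using f.bounded by blast
  have q_lower: "- K\<^sup>2 \<le> q x" for x
  proof -
    have "0 \<le> (norm x - K)\<^sup>2" by simp
    then show ?thesis using K[of x] by (simp add: q_def power2_diff)
  qed
  define m where "m = Inf (range q)"
  have bdd: "bdd_below (range q)"
    using q_lower by (auto intro!: bdd_belowI)
  have m_le: "m \<le> q x" for x
    unfolding m_def using bdd by (simp add: cInf_lower)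
  have "\<exists>x. q x < m + inverse (real (Suc n))" for n
    using cInf_lessD[of "range q" "m + inverse (real (Suc n))"] by (auto simp: m_def)
  then obtain X where X: "\<And>n. q (X n) < m + inverse (real (Suc n))"
    by metis
  have par: "(norm (x - y))\<^sup>2 \<le> 2 * (q x - m) + 2 * (q y - m)" for x y
  proof -
    have "(norm (x - y))\<^sup>2 = 2 * q x + 2 * q y - 4 * q ((1/2) *\<^sub>R (x + y))"
      by (simp add: q_def power2_norm_eq_inner inner_add_left inner_add_right inner_diff_left
          inner_diff_right f.scaleR f.add inner_commute algebra_simps)
    then show ?thesis using m_le[of "(1/2) *\<^sub>R (x + y)"] by simp
  qed
  have "Cauchy X"
  proof (rule CauchyI)
    fix e :: real assume e: "e > 0"
    then obtain N where N: "inverse (real (Suc N)) < e\<^sup>2 / 4"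
      using reals_Archimedean[of "e\<^sup>2 / 4"] by auto
    have small: "q (X n) - m < e\<^sup>2 / 4" if "n \<ge> N" for n
    proof -
      have "inverse (real (Suc n)) \<le> inverse (real (Suc N))"
        using that by (simp add: field_simps)
      then show ?thesis using X[of n] N by linarith
    qed
    have "norm (X i - X j) < e" if "i \<ge> N" "j \<ge> N" for i j
    proof -
      have "(norm (X i - X j))\<^sup>2 < e\<^sup>2"
        using par[of "X i" "X j"] small[OF that(1)] small[OF that(2)] by argo
      then show ?thesis using e by (simp add: power_less_imp_less_base)
    qed
    then show "\<exists>N. \<forall>i\<ge>N. \<forall>j\<ge>N. norm (X i - X j) < e" by blast
  qed
  then obtain z where z: "X \<longlonglongrightarrow> z"
    by (metis Cauchy_convergent_iff convergent_def)
  have "q z \<le> m"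
  proof (rule LIMSEQ_le)
    show "(\<lambda>n. q (X n)) \<longlonglongrightarrow> q z"
      unfolding q_def by (intro tendsto_intros z f.tendsto)
    show "(\<lambda>n. m + inverse (real (Suc n))) \<longlonglongrightarrow> m"
      using LIMSEQ_inverse_real_of_nat_add by blast
    show "\<exists>N. \<forall>n\<ge>N. q (X n) \<le> m + inverse (real (Suc n))"
      using X by (meson less_imp_le)
  qed
  have "f x = inner z x" for x
  proof -
    define d where "d = inner z x - f x"
    define s where "s = inner x x"
    define t where "t = - d / (s + 1)"
    have s: "s \<ge> 0" by (simp add: s_def)
    have "q z \<le> q (z + t *\<^sub>R x)"
      using \<open>q z \<le> m\<close> m_le[of "z + t *\<^sub>R x"] by linarith
    moreover have "(norm (z + t *\<^sub>R x))\<^sup>2 = (norm z)\<^sup>2 + 2 * t * inner z x + t\<^sup>2 * s"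
      unfolding power2_norm_eq_inner s_def
      by (simp add: inner_add_left inner_add_right inner_commute power2_eq_square)
    ultimately have "0 \<le> 2 * t * d + t\<^sup>2 * s"
      by (simp add: q_def d_def f.add f.scaleR algebra_simps)
    also have d: "d = - (t * (s + 1))"
      using s by (simp add: t_def)
    finally have "t\<^sup>2 * (s + 2) \<le> 0"
      by (simp add: algebra_simps power2_eq_square)
    then have "t = 0"
      using s by (simp add: mult_le_0_iff)
    then have "d = 0"
      using d by simp
    then show ?thesis by (simp add: d_def)
  qed
  then show ?thesis by blast
qed

lemma adj_exists:
  fixes A :: "'h::chilbert_space \<Rightarrow>\<^sub>L 'h"
  assumes "A \<in> bounded_operators"
  shows "is_adjoint A (adj A)"
proof -
  have "\<exists>z. \<forall>x. inner (A x) y = inner z x" for y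
    by (rule riesz_representation) (intro bounded_linear_intros blinfun.bounded_linear_right)
  then obtain B where B: "\<And>x y. inner (A x) y = inner (B y) x"
    by metis
  have B': "inner x (B y) = inner (A x) y" for x y
    by (metis B inner_commute)
  have "bounded_linear B"
  proof (rule bounded_linear_intro[where K = "norm A"])
    show "B (x + y) = B x + B y" for x y
      by (subst vector_eq_ldot[symmetric]) (simp add: B' inner_add_right)
    show "B (r *\<^sub>R x) = r *\<^sub>R B x" for r x
      by (subst vector_eq_ldot[symmetric]) (simp add: B')
    show "norm (B y) \<le> norm y * norm A" for y
    proof -
      have "norm (B y) * norm (B y) = inner (A (B y)) y"
        by (metis B' power2_eq_square power2_norm_eq_inner)
      also have "\<dots> \<le> norm (A (B y)) * norm y"
        by (rule norm_cauchy_schwarz)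
      also have "\<dots> \<le> norm (B y) * (norm y * norm A)"
        using mult_right_mono[OF norm_blinfun[of A "B y"], of "norm y"]
        by (simp add: mult.commute mult.left_commute)
      finally show ?thesis
        by (cases "norm (B y) = 0") (simp_all add: mult_le_cancel_left)
    qed
  qed
  moreover have "cinner (A x) y = cinner x (B y)" for x y
  proof -
    have "inner x (B (\<i> *\<^sub>C y)) = inner (A x) (\<i> *\<^sub>C y)" by (rule B')
    also have "\<dots> = inner (A ((- \<i>) *\<^sub>C x)) y"
      using assms by (simp add: bounded_operators_def inner_scaleC_left)
    also have "\<dots> = inner x (\<i> *\<^sub>C B y)"
      by (simp add: inner_scaleC_left flip: B')
    finally show ?thesis
      by (simp add: cinner_eq_inner B')
  qed
  ultimately have "is_adjoint A (Blinfun B)"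
    by (simp add: is_adjoint_def bounded_linear_Blinfun_apply)
  then show ?thesis using adjI by metis
qed


section \<open>Von Neumann algebras and type II_1 factors\<close>

definition von_neumann_algebra :: "('h::chilbert_space \<Rightarrow>\<^sub>L 'h) set \<Rightarrow> bool" where
  "von_neumann_algebra M \<longleftrightarrow>
    M \<subseteq> bounded_operators \<and>
    id_blinfun \<in> M \<and>
    (\<forall>A\<in>M. \<forall>B\<in>M. A + B \<in> M) \<and>
    (\<forall>a. \<forall>A\<in>M. a *\<^sub>C A \<in> M) \<and>
    (\<forall>A\<in>M. \<forall>B\<in>M. A o\<^sub>L B \<in> M) \<and>
    (\<forall>A\<in>M. adj A \<in> M) \<and>
    closedin strong_operator_topology M"

definition center :: "('h::chilbert_space \<Rightarrow>\<^sub>L 'h) set \<Rightarrow> ('h \<Rightarrow>\<^sub>L 'h) set" where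
  "center M = {A \<in> M. \<forall>B\<in>M. A o\<^sub>L B = B o\<^sub>L A}"

definition factor :: "('h::chilbert_space \<Rightarrow>\<^sub>L 'h) set \<Rightarrow> bool" where
  "factor M \<longleftrightarrow>
    von_neumann_algebra M \<and> (id_blinfun :: 'h \<Rightarrow>\<^sub>L 'h) \<noteq> 0 \<and>
    center M = range (\<lambda>a. a *\<^sub>C id_blinfun)"

definition projection :: "('h::chilbert_space \<Rightarrow>\<^sub>L 'h) set \<Rightarrow> ('h \<Rightarrow>\<^sub>L 'h) \<Rightarrow> bool" where
  "projection M P \<longleftrightarrow> P \<in> M \<and> P o\<^sub>L P = P \<and> adj P = P"

definition subprojection :: "('h::chilbert_space \<Rightarrow>\<^sub>L 'h) \<Rightarrow> ('h \<Rightarrow>\<^sub>L 'h) \<Rightarrow> bool" where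
  "subprojection Q P \<longleftrightarrow> P o\<^sub>L Q = Q"

text \<open>Murray--von Neumann equivalence of projections, relative to \<open>M\<close>.\<close>

definition mvn_equiv ::
  "('h::chilbert_space \<Rightarrow>\<^sub>L 'h) set \<Rightarrow> ('h \<Rightarrow>\<^sub>L 'h) \<Rightarrow> ('h \<Rightarrow>\<^sub>L 'h) \<Rightarrow> bool" where
  "mvn_equiv M P Q \<longleftrightarrow> (\<exists>V\<in>M. adj V o\<^sub>L V = P \<and> V o\<^sub>L adj V = Q)"

definition finite_projection :: "('h::chilbert_space \<Rightarrow>\<^sub>L 'h) set \<Rightarrow> ('h \<Rightarrow>\<^sub>L 'h) \<Rightarrow> bool" where
  "finite_projection M P \<longleftrightarrow>
    projection M P \<and>
    (\<forall>Q. projection M Q \<and> subprojection Q P \<and> mvn_equiv M P Q \<longrightarrow> Q = P)"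

definition abelian_projection :: "('h::chilbert_space \<Rightarrow>\<^sub>L 'h) set \<Rightarrow> ('h \<Rightarrow>\<^sub>L 'h) \<Rightarrow> bool" where
  "abelian_projection M P \<longleftrightarrow>
    projection M P \<and>
    (\<forall>A\<in>M. \<forall>B\<in>M.
      (P o\<^sub>L A o\<^sub>L P) o\<^sub>L (P o\<^sub>L B o\<^sub>L P) = (P o\<^sub>L B o\<^sub>L P) o\<^sub>L (P o\<^sub>L A o\<^sub>L P))"

text \<open>
  Type II means that there is no nonzero abelian projection but there is a finite projection of
  central carrier \<open>1\<close>; the index 1 means that the identity itself is finite, which already
  gives the second half of type II.
\<close>

definition type_II1_factor :: "('h::chilbert_space \<Rightarrow>\<^sub>L 'h) set \<Rightarrow> bool" where
  "type_II1_factor M \<longleftrightarrow>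
    factor M \<and> finite_projection M id_blinfun \<and> (\<forall>P. abelian_projection M P \<longrightarrow> P = 0)"


section \<open>Automorphisms\<close>

definition star_automorphism ::
  "('h::chilbert_space \<Rightarrow>\<^sub>L 'h) set \<Rightarrow> (('h \<Rightarrow>\<^sub>L 'h) \<Rightarrow> ('h \<Rightarrow>\<^sub>L 'h)) \<Rightarrow> bool" where
  "star_automorphism M \<theta> \<longleftrightarrow>
    bij_betw \<theta> M M \<and>
    (\<forall>A\<in>M. \<forall>B\<in>M. \<theta> (A + B) = \<theta> A + \<theta> B) \<and>
    (\<forall>a. \<forall>A\<in>M. \<theta> (a *\<^sub>C A) = a *\<^sub>C \<theta> A) \<and>
    (\<forall>A\<in>M. \<forall>B\<in>M. \<theta> (A o\<^sub>L B) = \<theta> A o\<^sub>L \<theta> B) \<and>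
    (\<forall>A\<in>M. \<theta> (adj A) = adj (\<theta> A))"

definition unitaries :: "('h::chilbert_space \<Rightarrow>\<^sub>L 'h) set \<Rightarrow> ('h \<Rightarrow>\<^sub>L 'h) set" where
  "unitaries M = {U \<in> M. adj U o\<^sub>L U = id_blinfun \<and> U o\<^sub>L adj U = id_blinfun}"

definition locally_inner ::
  "('h::chilbert_space \<Rightarrow>\<^sub>L 'h) set \<Rightarrow> (('h \<Rightarrow>\<^sub>L 'h) \<Rightarrow> ('h \<Rightarrow>\<^sub>L 'h)) \<Rightarrow> bool" where
  "locally_inner M \<theta> \<longleftrightarrow> (\<forall>X\<in>M. \<exists>U\<in>unitaries M. \<theta> X = U o\<^sub>L X o\<^sub>L adj U)"

definition inner_automorphism ::
  "('h::chilbert_space \<Rightarrow>\<^sub>L 'h) set \<Rightarrow> (('h \<Rightarrow>\<^sub>L 'h) \<Rightarrow> ('h \<Rightarrow>\<^sub>L 'h)) \<Rightarrow> bool" where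
  "inner_automorphism M \<theta> \<longleftrightarrow> (\<exists>U\<in>unitaries M. \<forall>X\<in>M. \<theta> X = U o\<^sub>L X o\<^sub>L adj U)"

end

theory Submission
  imports Defs "HOL-Combinatorics.Transposition"
begin

text \<open>
  Let \<open>G\<close> be the group of permutations of the reals of countable support, \<open>M\<close> its von Neumann
  algebra, and \<open>\<theta>\<close> the automorphism of \<open>M\<close> induced by \<open>\<alpha>\<close>, the conjugation of \<open>G\<close> with \<open>x \<mapsto> - x\<close>,
  whose support is uncountable.  An element of \<open>M\<close> is determined by a square-summable family of coefficients
  indexed by \<open>G\<close>, of which only countably many are nonzero.  On a countable subset of \<open>G\<close>, conjugation
  with \<open>x \<mapsto> - x\<close> agrees with conjugation by some element of \<open>G\<close>, so \<open>\<theta>\<close> is locally inner.  A unitary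
  implementing \<open>\<theta>\<close> would have coefficients constant on the classes \<open>{\<alpha>(g) s g\<^sup>-\<^sup>1}\<close>, which are
  infinite because no element of \<open>G\<close> agrees with \<open>x \<mapsto> - x\<close>; so all its coefficients would vanish.
\<close>

section \<open>Bounded operators\<close>

lemma cinner_adj:
  assumes "A \<in> bounded_operators"
  shows "cinner (A x) y = cinner x (adj A y)"
  using adj_exists[OF assms] by (simp add: is_adjoint_def)

lemma adj_in_bounded_operators:
  assumes "A \<in> bounded_operators"
  shows "adj A \<in> bounded_operators"
proof -
  have "inner z (adj A (a *\<^sub>C x)) = inner z (a *\<^sub>C adj A x)" for a x z
    by (simp add: inner_eq_Re_cinner cinner_scaleC_right flip: cinner_adj[OF assms])
  then have "adj A (a *\<^sub>C x) = a *\<^sub>C adj A x" for a x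
    by (metis vector_eq_ldot)
  then show ?thesis by (simp add: bounded_operators_def)
qed

lemma adj_compose:
  assumes "A \<in> bounded_operators" "B \<in> bounded_operators"
  shows "adj (A o\<^sub>L B) = adj B o\<^sub>L adj A"
  by (rule adjI) (simp add: is_adjoint_def cinner_adj assms)

lemma adj_id: "adj id_blinfun = id_blinfun"
  by (rule adjI) (simp add: is_adjoint_def)

lemma adj_diff:
  assumes "A \<in> bounded_operators" "B \<in> bounded_operators"
  shows "adj (A - B) = adj A - adj B"
proof (rule adjI)
  have "cinner (x - y) z = cinner x z - cinner y z" for x y z :: 'a
    by (metis add_diff_cancel cinner_add_left diff_add_cancel)
  moreover have "cinner z (x - y) = cinner z x - cinner z y" for x y z :: 'a
    by (metis calculation cinner_commute complex_cnj_diff)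
  ultimately show "is_adjoint (A - B) (adj A - adj B)"
    by (simp add: is_adjoint_def cinner_adj assms blinfun.diff_left)
qed

lemma id_in_bounded_operators: "id_blinfun \<in> bounded_operators"
  by (simp add: bounded_operators_def)

lemma diff_in_bounded_operators:
  assumes "A \<in> bounded_operators" "B \<in> bounded_operators"
  shows "A - B \<in> bounded_operators"
proof -
  have "a *\<^sub>C (x - y) = a *\<^sub>C x - a *\<^sub>C y" for a and x y :: 'a
    by (metis add_diff_cancel diff_add_cancel scaleC_add_right)
  then show ?thesis
    using assms by (simp add: bounded_operators_def blinfun.diff_left)
qed

lemma compose_in_bounded_operators:
  assumes "A \<in> bounded_operators" "B \<in> bounded_operators"
  shows "A o\<^sub>L B \<in> bounded_operators"
  using assms by (simp add: bounded_operators_def)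

lemma blinfun_eq_iff: "A = B \<longleftrightarrow> (\<forall>x. blinfun_apply A x = blinfun_apply B x)"
  by (auto intro: blinfun_eqI)

text \<open>Evaluation at a point is continuous in the strong operator topology, so both sides
  depend continuously on \<open>A\<close>, and two continuous maps into a Hausdorff space agree on a
  closed set.\<close>

lemma closedin_commuting_operators:
  fixes S :: "'h::real_normed_vector \<Rightarrow> 'h"
  assumes "continuous_on UNIV S"
  shows "closedin strong_operator_topology {A :: 'h \<Rightarrow>\<^sub>L 'h. A (S x) = S (A x)}"
proof -
  have "continuous_map strong_operator_topology euclidean (S \<circ> (\<lambda>A. blinfun_apply A x))"
    using assms by (intro continuous_map_compose[OF strong_operator_topology_continuous_evaluation]) simp
  then have "closedin strong_operator_topology
      {A \<in> topspace strong_operator_topology. blinfun_apply A (S x) = (S \<circ> (\<lambda>A. blinfun_apply A x)) A}"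
    by (intro closedin_continuous_maps_eq[OF _ strong_operator_topology_continuous_evaluation]
        Hausdorff_space_euclidean)
  then show ?thesis by (simp add: strong_operator_topology_topspace)
qed


section \<open>Permutation operators\<close>

lift_definition ket :: "'i \<Rightarrow> 'i ell2" is "\<lambda>i j. if j = i then 1 else 0"
proof -
  fix i :: 'i
  have "(\<lambda>j. (cmod (if j = i then 1 else 0))\<^sup>2) summable_on {i}"
    by simp
  also have "?this \<longleftrightarrow> (\<lambda>j. (cmod (if j = i then 1 else 0))\<^sup>2) summable_on UNIV"
    by (rule summable_on_cong_neutral) auto
  finally show "(\<lambda>j. (cmod (if j = i then 1 else 0))\<^sup>2) summable_on UNIV" .
qed

lemma cinner_ket: "cinner x (ket i) = ell2_nth x i"
proof -
  have "cinner x (ket i) = (\<Sum>\<^sub>\<infinity>j\<in>{i}. ell2_nth x j)"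
    unfolding cinner_ell2_def by (rule infsum_cong_neutral) (auto simp: ket.rep_eq)
  then show ?thesis by simp
qed

lemma ell2_eqI: "(\<And>i. ell2_nth x i = ell2_nth y i) \<Longrightarrow> x = y"
  by (metis ell2_nth_inject ext)

lemma ket_nonzero: "ket i \<noteq> 0"
  by (metis ket.rep_eq zero_ell2.rep_eq zero_neq_one)

text \<open>A summable family of nonnegative reals has countable support. This is the source of
  local innerness: the coefficients of an operator involve only countably many group
  elements.\<close>

lemma countable_support_ell2: "countable {i. ell2_nth x i \<noteq> 0}"
  using summable_countable_real[OF square_summable_ell2[of x]] by simp

text \<open>Every point of a level set contributes the same positive amount to the squared norm.
  Coefficients constant on infinite classes must therefore vanish, which serves both the factor
  property and the failure of innerness.\<close>

lemma finite_level_set_ell2: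
  assumes "c \<noteq> 0"
  shows "finite {i. ell2_nth x i = c}"
proof (rule ccontr)
  assume inf: "infinite {i. ell2_nth x i = c}"
  obtain n :: nat where n: "(norm x)\<^sup>2 < n * (cmod c)\<^sup>2"
    using reals_Archimedean3[of "(cmod c)\<^sup>2"] assms by auto
  obtain F where F: "finite F" "card F = n" "F \<subseteq> {i. ell2_nth x i = c}"
    using infinite_arbitrarily_large[OF inf] by metis
  have "(\<Sum>i\<in>F. (cmod (ell2_nth x i))\<^sup>2) = (\<Sum>i\<in>F. (cmod c)\<^sup>2)"
    using F(3) by (intro sum.cong) auto
  then show False
    using sum_le_norm_ell2_sq[OF F(1), of x] n F(2) by simp
qed

text \<open>Coefficients are pulled back, so basis vectors move by the inverse of
  \<open>\<pi>\<close>. Boundedness, and with it a usable value of \<open>Blinfun\<close>, is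
  established for bijective \<open>\<pi>\<close>.\<close>

definition reindex :: "('i \<Rightarrow> 'i) \<Rightarrow> 'i ell2 \<Rightarrow>\<^sub>L 'i ell2" where
  "reindex \<pi> = Blinfun (\<lambda>x. Abs_ell2 (\<lambda>i. ell2_nth x (\<pi> i)))"

lemma ell2_nth_reindex:
  assumes "bij \<pi>"
  shows "ell2_nth (reindex \<pi> x) i = ell2_nth x (\<pi> i)"
proof -
  define f where "f x = Abs_ell2 (\<lambda>i. ell2_nth x (\<pi> i))" for x
  have f: "ell2_nth (f x) = (\<lambda>i. ell2_nth x (\<pi> i))" for x
    using summable_on_reindex_bij_betw[OF assms, of "\<lambda>i. (cmod (ell2_nth x i))\<^sup>2"]
    by (simp add: f_def Abs_ell2_inverse square_summable_ell2)
  have "bounded_linear f"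
  proof (rule bounded_linear_intro[where K = 1])
    show "norm (f x) \<le> norm x * 1" for x
    proof -
      have "(norm (f x))\<^sup>2 = (norm x)\<^sup>2"
        unfolding norm_ell2_sq f by (rule infsum_reindex_bij_betw[OF assms])
      then show ?thesis by simp
    qed
  qed (auto intro!: ell2_eqI simp: f plus_ell2.rep_eq scaleR_ell2.rep_eq)
  moreover have "reindex \<pi> = Blinfun f"
    by (simp add: reindex_def f_def[abs_def])
  ultimately show ?thesis by (simp add: bounded_linear_Blinfun_apply f)
qed

lemma reindex_in_bounded_operators:
  assumes "bij \<pi>"
  shows "reindex \<pi> \<in> bounded_operators"
  unfolding bounded_operators_def
  by (auto intro!: ell2_eqI simp: ell2_nth_reindex[OF assms] scaleC_ell2.rep_eq)

lemma reindex_inv: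
  assumes "bij \<pi>"
  shows "reindex \<pi> (reindex (inv \<pi>) x) = x" "reindex (inv \<pi>) (reindex \<pi> x) = x"
  by (rule ell2_eqI; simp add: ell2_nth_reindex assms bij_imp_bij_inv
      surj_f_inv_f[OF bij_is_surj[OF assms]] inv_f_f[OF bij_is_inj[OF assms]])+

lemma adj_reindex:
  assumes "bij \<pi>"
  shows "adj (reindex \<pi>) = reindex (inv \<pi>)"
proof (rule adjI)
  have "cinner (reindex \<pi> x) y = cinner x (reindex (inv \<pi>) y)" for x y
    unfolding cinner_ell2_def
    using infsum_reindex_bij_betw[OF assms, of "\<lambda>i. ell2_nth x i * cnj (ell2_nth y (inv \<pi> i))"]
    by (simp add: ell2_nth_reindex assms bij_imp_bij_inv bij_is_inj)
  then show "is_adjoint (reindex \<pi>) (reindex (inv \<pi>))"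
    by (simp add: is_adjoint_def)
qed

lemma reindex_ket:
  assumes "bij \<pi>"
  shows "reindex \<pi> (ket (\<pi> i)) = ket i"
  using assms by (auto intro!: ell2_eqI simp: ell2_nth_reindex ket.rep_eq bij_is_inj inj_eq)


section \<open>The von Neumann algebra of a group\<close>

context group
begin

lemma inverse_mult_cancel [simp]:
  "a \<^bold>* (inverse a \<^bold>* b) = b" "inverse a \<^bold>* (a \<^bold>* b) = b"
  by (simp_all flip: assoc)

lemma bij_mult_left: "bij (\<lambda>x. a \<^bold>* x)"
  by (rule bij_betw_byWitness[where f' = "\<lambda>x. inverse a \<^bold>* x"]) auto

lemma bij_mult_right: "bij (\<lambda>x. x \<^bold>* a)"
  by (rule bij_betw_byWitness[where f' = "\<lambda>x. x \<^bold>* inverse a"]) (auto simp: assoc)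

text \<open>The left and, below, the right regular representation. As \<open>reindex\<close> pulls
  back, the left one takes an inverse in order to be a homomorphism and the right one does
  not.\<close>

definition lt :: "'a \<Rightarrow> 'a ell2 \<Rightarrow>\<^sub>L 'a ell2" where
  "lt g = reindex (\<lambda>x. inverse g \<^bold>* x)"

definition rt :: "'a \<Rightarrow> 'a ell2 \<Rightarrow>\<^sub>L 'a ell2" where
  "rt g = reindex (\<lambda>x. x \<^bold>* g)"

text \<open>
  Taking the commutant of the right translations, rather than the closed span of the left
  translations, makes closedness immediate and avoids the commutation theorem.
\<close>

definition group_vn :: "('a ell2 \<Rightarrow>\<^sub>L 'a ell2) set" where
  "group_vn = {A \<in> bounded_operators. \<forall>g x. A (rt g x) = rt g (A x)}"

lemma ell2_nth_lt: "ell2_nth (lt g x) s = ell2_nth x (inverse g \<^bold>* s)"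
  by (simp add: lt_def ell2_nth_reindex bij_mult_left)

lemma ell2_nth_rt: "ell2_nth (rt g x) s = ell2_nth x (s \<^bold>* g)"
  by (simp add: rt_def ell2_nth_reindex bij_mult_right)

lemma adj_lt: "adj (lt g) = lt (inverse g)"
proof -
  have "inv (\<lambda>x. inverse g \<^bold>* x) = (\<lambda>x. g \<^bold>* x)"
    by (rule inv_equality) auto
  then show ?thesis by (simp add: lt_def adj_reindex bij_mult_left)
qed

lemma adj_rt: "adj (rt g) = rt (inverse g)"
proof -
  have "inv (\<lambda>x. x \<^bold>* g) = (\<lambda>x. x \<^bold>* inverse g)"
    by (rule inv_equality) (auto simp: assoc)
  then show ?thesis by (simp add: rt_def adj_reindex bij_mult_right)
qed

lemma lt_ket: "lt g (ket s) = ket (g \<^bold>* s)"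
  using reindex_ket[OF bij_mult_left, of "inverse g" "g \<^bold>* s"] by (simp add: lt_def)

lemma rt_ket: "rt g (ket s) = ket (s \<^bold>* inverse g)"
  using reindex_ket[OF bij_mult_right, of g "s \<^bold>* inverse g"] by (simp add: rt_def assoc)

lemma lt_lt: "lt g (lt h x) = lt (g \<^bold>* h) x"
  by (rule ell2_eqI) (simp add: ell2_nth_lt inverse_distrib_swap assoc)

lemma lt_one: "lt \<^bold>1 x = x"
  by (rule ell2_eqI) (simp add: ell2_nth_lt)

lemma group_vn_bounded: "A \<in> group_vn \<Longrightarrow> A \<in> bounded_operators"
  by (simp add: group_vn_def)

lemma group_vn_rt: "A \<in> group_vn \<Longrightarrow> A (rt g x) = rt g (A x)"
  by (simp add: group_vn_def)

lemma lt_in_group_vn: "lt g \<in> group_vn"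
  unfolding group_vn_def
  by (auto intro!: ell2_eqI simp: ell2_nth_lt ell2_nth_rt assoc)
    (simp add: lt_def reindex_in_bounded_operators bij_mult_left)

lemma lt_unitary: "lt g \<in> unitaries group_vn"
  by (auto simp: unitaries_def lt_in_group_vn adj_lt lt_lt lt_one intro: blinfun_eqI)

text \<open>The set of right translations is closed under adjoints: the adjoint of the commutation
  with \<open>rt (inverse g)\<close> is the commutation with \<open>rt g\<close>.\<close>

lemma adj_in_group_vn:
  assumes "A \<in> group_vn"
  shows "adj A \<in> group_vn"
proof -
  have rt: "rt g \<in> bounded_operators" for g
    by (simp add: rt_def reindex_in_bounded_operators bij_mult_right)
  have "A o\<^sub>L rt (inverse g) = rt (inverse g) o\<^sub>L A" for g
    by (rule blinfun_eqI) (simp add: group_vn_rt[OF assms])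
  then have "adj A o\<^sub>L rt g = rt g o\<^sub>L adj A" for g
    by (metis adj_compose adj_rt assms group_vn_bounded inverse_inverse rt)
  then have "adj A (rt g x) = rt g (adj A x)" for g x
    by (metis blinfun_apply_blinfun_compose)
  then show ?thesis
    using assms by (simp add: group_vn_def adj_in_bounded_operators)
qed

lemma compose_in_group_vn: "A \<in> group_vn \<Longrightarrow> B \<in> group_vn \<Longrightarrow> A o\<^sub>L B \<in> group_vn"
  by (simp add: group_vn_def compose_in_bounded_operators)

lemma id_in_group_vn: "id_blinfun \<in> group_vn"
  by (simp add: group_vn_def id_in_bounded_operators)

lemma diff_in_group_vn: "A \<in> group_vn \<Longrightarrow> B \<in> group_vn \<Longrightarrow> A - B \<in> group_vn"
  by (simp add: group_vn_def diff_in_bounded_operators blinfun.diff_left blinfun.diff_right)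

lemma scaleC_in_group_vn:
  assumes "A \<in> group_vn"
  shows "a *\<^sub>C A \<in> group_vn"
proof -
  have "rt g (a *\<^sub>C x) = a *\<^sub>C rt g x" for g x
    by (rule ell2_eqI) (simp add: ell2_nth_rt scaleC_ell2.rep_eq)
  then show ?thesis
    using assms by (simp add: group_vn_def bounded_operators_def scaleC_blinfun.rep_eq
        scaleC_scaleC mult.commute)
qed

lemma von_neumann_algebra_group_vn: "von_neumann_algebra group_vn"
proof -
  \<comment> \<open>The ambient operators are only real-linear, so complex linearity is expressed as
    commutation with scalar multiplications, a closed condition of the same shape as commutation
    with right translations.\<close>
  have "group_vn = (\<Inter>(a, x). {A :: 'a ell2 \<Rightarrow>\<^sub>L 'a ell2. A (a *\<^sub>C x) = a *\<^sub>C A x}) \<inter>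
      (\<Inter>(g, x). {A :: 'a ell2 \<Rightarrow>\<^sub>L 'a ell2. A (rt g x) = rt g (A x)})"
    by (auto simp: group_vn_def bounded_operators_def)
  moreover have "closedin strong_operator_topology \<dots>"
    by (intro closedin_Int closedin_INT)
      (auto intro!: closedin_commuting_operators linear_continuous_on bounded_linear_scaleC
        blinfun.bounded_linear_right)
  ultimately have "closedin strong_operator_topology group_vn" by simp
  moreover have "A + B \<in> group_vn" if "A \<in> group_vn" "B \<in> group_vn" for A B
    using that by (simp add: group_vn_def bounded_operators_def blinfun.add_left blinfun.add_right
        scaleC_add_right)
  ultimately show ?thesis
    by (auto simp: von_neumann_algebra_def group_vn_bounded id_in_group_vn adj_in_group_vn
        compose_in_group_vn scaleC_in_group_vn)
qed

section \<open>Operators determined by their coefficients\<close>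

lemma group_vn_ket:
  assumes "A \<in> group_vn"
  shows "A (ket s) = rt (inverse s) (A (ket \<^bold>1))"
  by (simp add: rt_ket flip: group_vn_rt[OF assms])

text \<open>The basis vector at the identity is separating. Right translation makes \<open>A\<close>
  vanish on every basis vector, hence all matrix entries of \<open>adj A\<close> vanish; pairing
  \<open>A x\<close> with \<open>ket j\<close> then gives zero for every \<open>x\<close>. The
  detour through the adjoint replaces a density argument.\<close>

lemma group_vn_eq_0:
  assumes A: "A \<in> group_vn" and 0: "A (ket \<^bold>1) = 0"
  shows "A = 0"
proof -
  have bd: "A \<in> bounded_operators" using A by (rule group_vn_bounded)
  have "ell2_nth (adj A (ket j)) i = 0" for i j
  proof -
    have "ell2_nth (adj A (ket j)) i = cnj (cinner (A (ket i)) (ket j))"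
      by (metis bd cinner_adj cinner_commute cinner_ket)
    also have "A (ket i) = 0"
      by (simp add: group_vn_ket[OF A, of i] 0 blinfun.zero_right)
    finally show ?thesis by (simp add: cinner_ket zero_ell2.rep_eq)
  qed
  then have adj0: "adj A (ket j) = 0" for j
    by (intro ell2_eqI) (simp add: zero_ell2.rep_eq)
  have "ell2_nth (A x) j = 0" for x j
  proof -
    have "ell2_nth (A x) j = cinner x (adj A (ket j))"
      by (metis bd cinner_adj cinner_ket)
    then show ?thesis by (simp add: adj0 cinner_ell2_def zero_ell2.rep_eq)
  qed
  then show ?thesis
    by (intro blinfun_eqI ell2_eqI) (simp add: zero_ell2.rep_eq)
qed

lemma group_vn_eqI:
  assumes "A \<in> group_vn" "B \<in> group_vn" "A (ket \<^bold>1) = B (ket \<^bold>1)"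
  shows "A = B"
  using group_vn_eq_0[of "A - B"] assms by (simp add: diff_in_group_vn blinfun.diff_left)

section \<open>Trace and finiteness of the identity\<close>

lemma ell2_nth_adj:
  assumes "A \<in> group_vn"
  shows "ell2_nth (adj A (ket \<^bold>1)) s = cnj (ell2_nth (A (ket \<^bold>1)) (inverse s))"
proof -
  have "ell2_nth (adj A (ket \<^bold>1)) s = cnj (cinner (A (ket s)) (ket \<^bold>1))"
    by (metis assms cinner_adj cinner_commute cinner_ket group_vn_bounded)
  then show ?thesis
    by (simp add: cinner_ket group_vn_ket[OF assms, of s] ell2_nth_rt)
qed

text \<open>The vector state at the identity is a trace: its value on a product is the sum of the
  products of coefficients at \<open>s\<close> and \<open>inverse s\<close>, which is symmetric
  under inversion of \<open>s\<close>.\<close>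

lemma trace_commute:
  assumes "A \<in> group_vn" "B \<in> group_vn"
  shows "cinner (A (B (ket \<^bold>1))) (ket \<^bold>1) = cinner (B (A (ket \<^bold>1))) (ket \<^bold>1)"
proof -
  have tr: "cinner (A (B (ket \<^bold>1))) (ket \<^bold>1) =
      (\<Sum>\<^sub>\<infinity>s. ell2_nth (B (ket \<^bold>1)) s * ell2_nth (A (ket \<^bold>1)) (inverse s))"
    if "A \<in> group_vn" for A B
    using that by (simp add: cinner_adj group_vn_bounded cinner_ell2_def[of _ "adj _ _"] ell2_nth_adj)
  have "bij inverse"
    by (rule bij_betw_byWitness[where f' = inverse]) auto
  from infsum_reindex_bij_betw[OF this, of "\<lambda>s. ell2_nth (B (ket \<^bold>1)) s * ell2_nth (A (ket \<^bold>1)) (inverse s)"]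
  show ?thesis by (simp add: tr assms mult.commute)
qed

text \<open>Equivalent projections have equal trace, so the complement \<open>E\<close> of
  \<open>Q\<close> has trace zero. As \<open>E\<close> is a projection, its trace is the squared
  norm of its value at a separating vector, whence \<open>E\<close> is zero.\<close>

lemma finite_projection_id: "finite_projection group_vn id_blinfun"
proof -
  have "Q = id_blinfun" if Q: "projection group_vn Q" "mvn_equiv group_vn id_blinfun Q" for Q
  proof -
    obtain V where V: "V \<in> group_vn" "adj V o\<^sub>L V = id_blinfun" "V o\<^sub>L adj V = Q"
      using Q(2) by (auto simp: mvn_equiv_def)
    define E where "E = id_blinfun - Q"
    have Qp: "Q \<in> group_vn" "adj Q = Q" "\<And>x. Q (Q x) = Q x"
      using Q(1) unfolding projection_def by (auto simp flip: blinfun_apply_blinfun_compose)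
    have E: "E \<in> group_vn" "adj E = E" "E o\<^sub>L E = E"
      using Qp by (simp_all add: E_def diff_in_group_vn id_in_group_vn adj_diff adj_id
          id_in_bounded_operators group_vn_bounded)
        (simp add: blinfun_eq_iff blinfun.diff_left blinfun.diff_right)
    have "Q (ket \<^bold>1) = V (adj V (ket \<^bold>1))" "adj V (V (ket \<^bold>1)) = ket \<^bold>1"
      using V(2,3) by (metis blinfun_apply_blinfun_compose, metis blinfun_apply_blinfun_compose id_blinfun.rep_eq)
    then have "cinner (Q (ket \<^bold>1)) (ket \<^bold>1) = cinner (ket \<^bold>1) (ket \<^bold>1)"
      using trace_commute[OF V(1) adj_in_group_vn[OF V(1)]] by simp
    then have "cinner (E (ket \<^bold>1)) (ket \<^bold>1) = 0"
      by (simp add: E_def cinner_ket blinfun.diff_left minus_ell2.rep_eq)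
    then have "cinner (E (ket \<^bold>1)) (E (ket \<^bold>1)) = 0"
      by (metis E blinfun_apply_blinfun_compose cinner_adj group_vn_bounded)
    then have "E (ket \<^bold>1) = 0"
      by (metis inner_eq_Re_cinner inner_eq_zero_iff zero_complex.sel(1))
    then show "Q = id_blinfun"
      using group_vn_eq_0[OF E(1)] by (simp add: E_def)
  qed
  moreover have "projection group_vn id_blinfun"
    by (simp add: projection_def id_in_group_vn adj_id blinfun_eq_iff)
  ultimately show ?thesis
    unfolding finite_projection_def by blast
qed

text \<open>
  The coefficients of a central element are constant on conjugacy classes; being
  square-summable, they vanish off the identity.
\<close>

lemma factor_group_vn:
  assumes icc: "\<And>s. s \<noteq> \<^bold>1 \<Longrightarrow> infinite (range (\<lambda>g. g \<^bold>* s \<^bold>* inverse g))"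
  shows "factor group_vn"
proof -
  have "A \<in> range (\<lambda>a. a *\<^sub>C id_blinfun)" if "A \<in> center group_vn" for A
  proof -
    have A: "A \<in> group_vn" and comm: "\<And>g. A o\<^sub>L lt g = lt g o\<^sub>L A"
      using that lt_in_group_vn by (auto simp: center_def)
    define \<xi> where "\<xi> = A (ket \<^bold>1)"
    \<comment> \<open>Commutation with left and with right translations gives two expressions for
      \<open>A (ket g)\<close>; their coefficients at the product of \<open>g\<close> and
      \<open>s\<close> are compared.\<close>
    have inv: "ell2_nth \<xi> (g \<^bold>* s \<^bold>* inverse g) = ell2_nth \<xi> s" for g s
    proof -
      have "A (ket g) = lt g \<xi>"
        by (metis \<xi>_def comm blinfun_apply_blinfun_compose lt_ket right_neutral)
      then have "ell2_nth (rt (inverse g) \<xi>) (g \<^bold>* s) = ell2_nth (lt g \<xi>) (g \<^bold>* s)"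
        by (simp add: group_vn_ket[OF A, of g] \<xi>_def)
      then show ?thesis by (simp add: ell2_nth_rt ell2_nth_lt)
    qed
    define a where "a = ell2_nth \<xi> \<^bold>1"
    \<comment> \<open>With the scalar part removed, the coefficient at the identity vanishes as
      well, so \<open>B\<close> is zero once the others do.\<close>
    define B where "B = A - a *\<^sub>C id_blinfun"
    have B: "B \<in> group_vn"
      by (simp add: B_def A diff_in_group_vn scaleC_in_group_vn id_in_group_vn)
    have B_nth: "ell2_nth (B (ket \<^bold>1)) s = (if s = \<^bold>1 then 0 else ell2_nth \<xi> s)" for s
      by (simp add: B_def \<xi>_def a_def blinfun.diff_left scaleC_blinfun.rep_eq minus_ell2.rep_eq
          scaleC_ell2.rep_eq ket.rep_eq)
    have "ell2_nth \<xi> s = 0" if "s \<noteq> \<^bold>1" for s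
    proof (rule ccontr)
      assume nz: "ell2_nth \<xi> s \<noteq> 0"
      have "range (\<lambda>g. g \<^bold>* s \<^bold>* inverse g) \<subseteq> {t. ell2_nth \<xi> t = ell2_nth \<xi> s}"
        using inv by auto
      then show False
        using finite_level_set_ell2[OF nz] icc[OF that] finite_subset by blast
    qed
    then have "B (ket \<^bold>1) = 0"
      by (intro ell2_eqI) (simp add: B_nth zero_ell2.rep_eq)
    then have "B = 0" using B by (rule group_vn_eq_0[rotated])
    then show ?thesis by (simp add: B_def)
  qed
  moreover have "a *\<^sub>C id_blinfun \<in> center group_vn" for a
    using group_vn_bounded
    by (auto simp: center_def scaleC_in_group_vn id_in_group_vn blinfun_eq_iff
        scaleC_blinfun.rep_eq bounded_operators_def)
  moreover have "(id_blinfun :: 'a ell2 \<Rightarrow>\<^sub>L 'a ell2) \<noteq> 0"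
    by (metis id_blinfun.rep_eq ket_nonzero zero_blinfun.rep_eq)
  ultimately show ?thesis
    by (auto simp: factor_def von_neumann_algebra_group_vn)
qed

text \<open>
  A projection has countable support, so it commutes with the left translations by elements
  centralizing that support; if it is abelian, it is then fixed by a commutator of such elements.
\<close>

lemma abelian_projection_group_vn_eq_0:
  assumes nonabelian_centralizer: "\<And>S. countable S \<Longrightarrow> \<exists>g h.
      (\<forall>s\<in>S. g \<^bold>* s = s \<^bold>* g \<and> h \<^bold>* s = s \<^bold>* h) \<and>
      g \<^bold>* (g \<^bold>* h \<^bold>* inverse g \<^bold>* inverse h) \<noteq> g \<^bold>* h \<^bold>* inverse g \<^bold>* inverse h \<^bold>* g"
    and P: "abelian_projection group_vn P"
  shows "P = 0"
proof -
  define p where "p = P (ket \<^bold>1)"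
  define S where "S = {s. ell2_nth p s \<noteq> 0}"
  have Pvn: "P \<in> group_vn" and PP: "P (P x) = P x" for x
    using P unfolding abelian_projection_def projection_def
    by (auto simp flip: blinfun_apply_blinfun_compose)
  have "countable S" unfolding S_def by (rule countable_support_ell2)
  then obtain g h where gS: "\<And>s. s \<in> S \<Longrightarrow> g \<^bold>* s = s \<^bold>* g"
    and hS: "\<And>s. s \<in> S \<Longrightarrow> h \<^bold>* s = s \<^bold>* h"
    and gh: "g \<^bold>* (g \<^bold>* h \<^bold>* inverse g \<^bold>* inverse h) \<noteq> g \<^bold>* h \<^bold>* inverse g \<^bold>* inverse h \<^bold>* g"
    using nonabelian_centralizer by meson
  have P_lt: "P (lt u x) = lt u (P x)" if u: "\<And>s. s \<in> S \<Longrightarrow> u \<^bold>* s = s \<^bold>* u" for u x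
  proof -
    \<comment> \<open>If one of the two points lies in \<open>S\<close>, then \<open>u\<close>
      commutes with it and the points coincide; otherwise both coefficients are zero.\<close>
    have "ell2_nth p (s \<^bold>* inverse u) = ell2_nth p (inverse u \<^bold>* s)" for s
    proof -
      have "s \<^bold>* inverse u = inverse u \<^bold>* s" if "s \<^bold>* inverse u \<in> S \<or> inverse u \<^bold>* s \<in> S"
        using that
      proof
        assume "s \<^bold>* inverse u \<in> S"
        from u[OF this] have "u \<^bold>* (s \<^bold>* inverse u) = s" by (simp add: assoc)
        then show ?thesis by (metis inverse_mult_cancel(2))
      next
        assume "inverse u \<^bold>* s \<in> S"
        from u[OF this] have "s = inverse u \<^bold>* s \<^bold>* u" by simp
        then have "s \<^bold>* inverse u = inverse u \<^bold>* s \<^bold>* u \<^bold>* inverse u" by simp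
        then show ?thesis by (simp add: assoc)
      qed
      then show ?thesis unfolding S_def by (metis (mono_tags) mem_Collect_eq)
    qed
    then have "P (lt u (ket \<^bold>1)) = lt u (P (ket \<^bold>1))"
      by (intro ell2_eqI) (simp add: lt_ket group_vn_ket[OF Pvn, of u] ell2_nth_rt ell2_nth_lt
          flip: p_def)
    then have "P o\<^sub>L lt u = lt u o\<^sub>L P"
      by (intro group_vn_eqI compose_in_group_vn Pvn lt_in_group_vn) simp
    then show ?thesis by (metis blinfun_apply_blinfun_compose)
  qed
  \<comment> \<open>The abelian condition is tested on two translations that commute with
    \<open>P\<close>, so all copies of \<open>P\<close> collapse onto \<open>p\<close>.\<close>
  have "(P o\<^sub>L lt g o\<^sub>L P) o\<^sub>L (P o\<^sub>L lt h o\<^sub>L P) = (P o\<^sub>L lt h o\<^sub>L P) o\<^sub>L (P o\<^sub>L lt g o\<^sub>L P)"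
    using P lt_in_group_vn unfolding abelian_projection_def by blast
  from arg_cong[OF this, of "\<lambda>A. A (ket \<^bold>1)"]
  have "lt g (lt h p) = lt h (lt g p)"
    by (simp add: P_lt[OF gS] P_lt[OF hS] PP p_def)
  then have fix_p: "lt (g \<^bold>* h) p = lt (h \<^bold>* g) p"
    by (simp add: lt_lt)
  have "ell2_nth p x = 0" for x
  proof (rule ccontr)
    assume "ell2_nth p x \<noteq> 0"
    then have x: "x \<in> S" by (simp add: S_def)
    \<comment> \<open>Invariance of \<open>p\<close> puts \<open>y\<close> into the support too.
      Both \<open>x\<close> and \<open>y\<close> commute with \<open>g\<close> and \<open>h\<close>,
      so the commutator of \<open>g\<close> and \<open>h\<close> equals \<open>inverse x\<close>
      times \<open>y\<close> and commutes with \<open>g\<close>, against the choice of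
      \<open>g\<close> and \<open>h\<close>.\<close>
    define y where "y = inverse (h \<^bold>* g) \<^bold>* (g \<^bold>* h \<^bold>* x)"
    have "ell2_nth p y = ell2_nth p x"
      using arg_cong[OF fix_p, of "\<lambda>z. ell2_nth z (g \<^bold>* h \<^bold>* x)"]
      by (simp add: y_def ell2_nth_lt)
    then have y: "y \<in> S" using x by (simp add: S_def)
    have "h \<^bold>* g \<^bold>* y = g \<^bold>* h \<^bold>* x" by (simp add: y_def)
    moreover have "h \<^bold>* g \<^bold>* y = y \<^bold>* (h \<^bold>* g)" by (metis assoc gS hS y)
    moreover have "g \<^bold>* h \<^bold>* x = x \<^bold>* (g \<^bold>* h)" by (metis assoc gS hS x)
    ultimately have "g \<^bold>* h = inverse x \<^bold>* (y \<^bold>* (h \<^bold>* g))"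
      by (metis inverse_mult_cancel(2))
    then have k: "g \<^bold>* h \<^bold>* inverse g \<^bold>* inverse h = inverse x \<^bold>* y"
      by (simp add: assoc)
    have "g \<^bold>* inverse x = inverse x \<^bold>* g"
      by (metis assoc gS[OF x] inverse_mult_cancel(2) right_inverse right_neutral)
    then have "g \<^bold>* (inverse x \<^bold>* y) = inverse x \<^bold>* y \<^bold>* g"
      by (metis assoc gS[OF y])
    then show False using gh k by simp
  qed
  then have "p = 0" by (intro ell2_eqI) (simp add: zero_ell2.rep_eq)
  then show ?thesis using group_vn_eq_0[OF Pvn] by (simp add: p_def)
qed

section \<open>Automorphisms induced by automorphisms of the group\<close>

definition induced :: "('a \<Rightarrow> 'a) \<Rightarrow> ('a ell2 \<Rightarrow>\<^sub>L 'a ell2) \<Rightarrow> ('a ell2 \<Rightarrow>\<^sub>L 'a ell2)" where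
  "induced \<alpha> A = reindex (inv \<alpha>) o\<^sub>L A o\<^sub>L reindex \<alpha>"

context
  fixes \<alpha> :: "'a \<Rightarrow> 'a"
  assumes bij: "bij \<alpha>" and hom: "\<And>a b. \<alpha> (a \<^bold>* b) = \<alpha> a \<^bold>* \<alpha> b"
begin

lemma hom_one: "\<alpha> \<^bold>1 = \<^bold>1"
  by (metis hom left_cancel right_neutral)

lemma \<alpha>_inv: "\<alpha> (inv \<alpha> a) = a" "inv \<alpha> (\<alpha> a) = a"
  using bij by (simp_all add: bij_is_surj surj_f_inv_f bij_is_inj)

lemma hom_inv: "inv \<alpha> (a \<^bold>* b) = inv \<alpha> a \<^bold>* inv \<alpha> b"
  by (metis hom \<alpha>_inv)

lemma induced_in_group_vn:
  assumes "A \<in> group_vn"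
  shows "induced \<alpha> A \<in> group_vn"
proof -
  have "reindex \<alpha> (rt g x) = rt (inv \<alpha> g) (reindex \<alpha> x)" for g x
    by (rule ell2_eqI) (simp add: ell2_nth_reindex ell2_nth_rt bij hom \<alpha>_inv)
  moreover have "reindex (inv \<alpha>) (rt (inv \<alpha> g) x) = rt g (reindex (inv \<alpha>) x)" for g x
    by (rule ell2_eqI) (simp add: ell2_nth_reindex ell2_nth_rt bij bij_imp_bij_inv hom_inv)
  ultimately show ?thesis
    using assms bij by (simp add: group_vn_def induced_def compose_in_bounded_operators
        reindex_in_bounded_operators bij_imp_bij_inv)
qed

text \<open>Conjugation is by the unitary \<open>reindex (inv \<alpha>)\<close>, which carries
  \<open>ket s\<close> to \<open>ket (\<alpha> s)\<close>; since \<alpha> fixes the identity,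
  coefficients are merely relabelled.\<close>

lemma ell2_nth_induced: "ell2_nth (induced \<alpha> A (ket \<^bold>1)) s = ell2_nth (A (ket \<^bold>1)) (inv \<alpha> s)"
  using reindex_ket[OF bij, of "\<^bold>1"] bij
  by (simp add: induced_def ell2_nth_reindex bij_imp_bij_inv hom_one)

lemma induced_lt: "induced \<alpha> (lt g) = lt (\<alpha> g)"
proof (rule group_vn_eqI)
  have "inv \<alpha> s = g \<longleftrightarrow> s = \<alpha> g" for s
    by (metis \<alpha>_inv)
  then show "induced \<alpha> (lt g) (ket \<^bold>1) = lt (\<alpha> g) (ket \<^bold>1)"
    by (intro ell2_eqI) (simp add: ell2_nth_induced lt_ket ket.rep_eq)
qed (simp_all add: induced_in_group_vn lt_in_group_vn)

text \<open>The two sides read the coefficients of \<open>A\<close> at \<open>inv \<alpha> x\<close>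
  and at the conjugate of \<open>x\<close> by \<open>inverse t\<close>. These points coincide as
  soon as one of them carries a nonzero coefficient.\<close>

lemma induced_inner_on_countable:
  assumes A: "A \<in> group_vn"
    and t: "\<And>s. ell2_nth (A (ket \<^bold>1)) s \<noteq> 0 \<Longrightarrow> \<alpha> s = t \<^bold>* s \<^bold>* inverse t"
  shows "induced \<alpha> A = lt t o\<^sub>L A o\<^sub>L adj (lt t)"
proof (rule group_vn_eqI)
  show "induced \<alpha> A \<in> group_vn" using A by (rule induced_in_group_vn)
  show "lt t o\<^sub>L A o\<^sub>L adj (lt t) \<in> group_vn"
    by (intro compose_in_group_vn adj_in_group_vn lt_in_group_vn A)
  have "ell2_nth (A (ket \<^bold>1)) (inv \<alpha> x) = ell2_nth (A (ket \<^bold>1)) (inverse t \<^bold>* x \<^bold>* t)" for x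
  proof -
    have "inv \<alpha> x = inverse t \<^bold>* x \<^bold>* t" if "ell2_nth (A (ket \<^bold>1)) (inv \<alpha> x) \<noteq> 0"
    proof -
      have "x = t \<^bold>* inv \<alpha> x \<^bold>* inverse t"
        using t[OF that] by (simp add: \<alpha>_inv)
      then have "inverse t \<^bold>* x \<^bold>* t = inverse t \<^bold>* (t \<^bold>* inv \<alpha> x \<^bold>* inverse t) \<^bold>* t" by simp
      then show ?thesis by (simp add: assoc)
    qed
    moreover have "inv \<alpha> x = inverse t \<^bold>* x \<^bold>* t"
      if "ell2_nth (A (ket \<^bold>1)) (inverse t \<^bold>* x \<^bold>* t) \<noteq> 0"
    proof -
      have "\<alpha> (inverse t \<^bold>* x \<^bold>* t) = x"
        using t[OF that] by (simp add: assoc)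
      then show ?thesis by (metis \<alpha>_inv(2))
    qed
    ultimately show ?thesis by metis
  qed
  then show "induced \<alpha> A (ket \<^bold>1) = (lt t o\<^sub>L A o\<^sub>L adj (lt t)) (ket \<^bold>1)"
    by (intro ell2_eqI) (simp add: ell2_nth_induced adj_lt lt_ket ell2_nth_lt
        group_vn_ket[OF A, of "inverse t"] ell2_nth_rt)
qed

text \<open>The unitary is \<open>lt t\<close>, with \<open>t\<close> chosen for the countable
  support of the coefficients of the given operator.\<close>

lemma locally_inner_induced:
  assumes "\<And>S. countable S \<Longrightarrow> \<exists>t. \<forall>s\<in>S. \<alpha> s = t \<^bold>* s \<^bold>* inverse t"
  shows "locally_inner group_vn (induced \<alpha>)"
  unfolding locally_inner_def
proof
  fix A assume A: "A \<in> group_vn"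
  obtain t where "\<forall>s\<in>{s. ell2_nth (A (ket \<^bold>1)) s \<noteq> 0}. \<alpha> s = t \<^bold>* s \<^bold>* inverse t"
    using assms[OF countable_support_ell2] by blast
  then have "induced \<alpha> A = lt t o\<^sub>L A o\<^sub>L adj (lt t)"
    by (intro induced_inner_on_countable A) auto
  then show "\<exists>U\<in>unitaries group_vn. induced \<alpha> A = U o\<^sub>L A o\<^sub>L adj U"
    using lt_unitary by blast
qed

text \<open>The coefficients of an implementing unitary are constant on twisted conjugacy classes.\<close>

lemma not_inner_induced:
  assumes twisted: "\<And>s. infinite (range (\<lambda>g. \<alpha> g \<^bold>* s \<^bold>* inverse g))"
  shows "\<not> inner_automorphism group_vn (induced \<alpha>)"
proof
  assume "inner_automorphism group_vn (induced \<alpha>)"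
  then obtain V where V: "V \<in> group_vn" "adj V o\<^sub>L V = id_blinfun"
    and implements: "\<And>X. X \<in> group_vn \<Longrightarrow> induced \<alpha> X = V o\<^sub>L X o\<^sub>L adj V"
    by (auto simp: inner_automorphism_def unitaries_def)
  define u where "u = V (ket \<^bold>1)"
  have VV: "adj V (V x) = x" for x
    using V(2) by (metis blinfun_apply_blinfun_compose id_blinfun.rep_eq)
  have inv: "ell2_nth u (\<alpha> g \<^bold>* s \<^bold>* inverse g) = ell2_nth u s" for g s
  proof -
    \<comment> \<open>This is the intertwining of \<open>lt g\<close> with
      \<open>lt (\<alpha> g)\<close> by \<open>V\<close>, applied to the basis vector at the
      identity.\<close>
    have "lt (\<alpha> g) u = V (ket g)"
      using implements[OF lt_in_group_vn, of g] by (simp add: induced_lt u_def VV lt_ket)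
    then have "lt (\<alpha> g) u = rt (inverse g) u"
      by (simp add: group_vn_ket[OF V(1), of g] u_def)
    from arg_cong[OF this, of "\<lambda>x. ell2_nth x (\<alpha> g \<^bold>* s)"] show ?thesis
      by (simp add: ell2_nth_lt ell2_nth_rt)
  qed
  have "ell2_nth u s = 0" for s
  proof (rule ccontr)
    assume nz: "ell2_nth u s \<noteq> 0"
    have "range (\<lambda>g. \<alpha> g \<^bold>* s \<^bold>* inverse g) \<subseteq> {t. ell2_nth u t = ell2_nth u s}"
      using inv by auto
    then show False
      using finite_level_set_ell2[OF nz] twisted finite_subset by blast
  qed
  then have "u = 0" by (intro ell2_eqI) (simp add: zero_ell2.rep_eq)
  then have "ket (\<^bold>1 :: 'a) = 0"
    using VV[of "ket \<^bold>1"] by (simp add: u_def blinfun.zero_right)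
  then show False by (simp add: ket_nonzero)
qed

end

lemma star_automorphism_induced:
  assumes bij: "bij \<alpha>" and hom: "\<And>a b. \<alpha> (a \<^bold>* b) = \<alpha> a \<^bold>* \<alpha> b"
  shows "star_automorphism group_vn (induced \<alpha>)"
proof -
  have inv_inv: "inv (inv \<alpha>) = \<alpha>" using bij by (rule inv_inv_eq)
  have cancel: "reindex \<alpha> (reindex (inv \<alpha>) x) = x" "reindex (inv \<alpha>) (reindex \<alpha> x) = x" for x
    using bij by (simp_all add: reindex_inv)
  have "bij_betw (induced \<alpha>) group_vn group_vn"
  proof (rule bij_betw_byWitness[where f' = "induced (inv \<alpha>)"])
    show "induced \<alpha> ` group_vn \<subseteq> group_vn"
      using induced_in_group_vn[OF assms] by auto
    show "induced (inv \<alpha>) ` group_vn \<subseteq> group_vn"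
      using induced_in_group_vn[OF bij_imp_bij_inv[OF bij] hom_inv[OF assms]] by auto
  qed (simp_all add: induced_def inv_inv blinfun_eq_iff cancel)
  moreover have "induced \<alpha> (a *\<^sub>C A) = a *\<^sub>C induced \<alpha> A" for a A
    using reindex_in_bounded_operators[OF bij_imp_bij_inv[OF bij]]
    by (simp add: induced_def blinfun_eq_iff scaleC_blinfun.rep_eq bounded_operators_def)
  moreover have "induced \<alpha> (adj A) = adj (induced \<alpha> A)" if "A \<in> group_vn" for A
    using bij that
    by (simp add: induced_def adj_compose adj_reindex compose_in_bounded_operators group_vn_bounded
        reindex_in_bounded_operators bij_imp_bij_inv inv_inv blinfun_eq_iff)
  ultimately show ?thesis
    by (auto simp: star_automorphism_def induced_def blinfun_eq_iff blinfun.add_left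
        blinfun.add_right cancel)
qed

end


section \<open>Permutations of countable support\<close>

text \<open>Countable rather than finite supports leave room for a permutation that is negation on a
  countable symmetric set and trivial elsewhere.\<close>

definition csupp_perms :: "('x \<Rightarrow> 'x) set" where
  "csupp_perms = {f. bij f \<and> countable {x. f x \<noteq> x}}"

lemma id_csupp_perms: "id \<in> csupp_perms"
  by (simp add: csupp_perms_def)

lemma comp_csupp_perms:
  assumes "f \<in> csupp_perms" "g \<in> csupp_perms"
  shows "f \<circ> g \<in> csupp_perms"
proof -
  have "{x. (f \<circ> g) x \<noteq> x} \<subseteq> {x. f x \<noteq> x} \<union> {x. g x \<noteq> x}" by auto
  then have "countable {x. (f \<circ> g) x \<noteq> x}"
    by (rule countable_subset) (use assms in \<open>simp add: csupp_perms_def\<close>)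
  then show ?thesis
    using assms by (simp add: csupp_perms_def bij_comp)
qed

lemma inv_csupp_perms:
  assumes "f \<in> csupp_perms"
  shows "inv f \<in> csupp_perms"
proof -
  have "bij f" using assms by (simp add: csupp_perms_def)
  then have "{x. inv f x \<noteq> x} = {x. f x \<noteq> x}"
    by (metis (no_types) bij_inv_eq_iff)
  then show ?thesis using assms by (simp add: csupp_perms_def bij_imp_bij_inv)
qed

lemma transpose_csupp_perms: "Transposition.transpose a b \<in> csupp_perms"
proof -
  have "{x. Transposition.transpose a b x \<noteq> x} \<subseteq> {a, b}" by (auto simp: Transposition.transpose_def)
  then have "countable {x. Transposition.transpose a b x \<noteq> x}"
    by (rule countable_subset) simp
  then show ?thesis by (simp add: csupp_perms_def)
qed

text \<open>Needed to index the Hilbert space by the reals. A permutation of countable support is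
  determined by a sequence of reals, hence by a set of naturals; conversely, there is a
  transposition for each real.\<close>

lemma csupp_perms_eqpoll_real: "(csupp_perms :: (real \<Rightarrow> real) set) \<approx> (UNIV :: real set)"
proof (rule lepoll_antisym)
  obtain b :: "real \<Rightarrow> nat set" where b: "inj b"
    using nat_sets_eqpoll_reals by (metis bij_betw_def eqpoll_def eqpoll_sym)
  \<comment> \<open>Inserting 0 makes the set nonempty, so that \<open>from_nat_into\<close>
    enumerates it even for the identity.\<close>
  define e where "e f = from_nat_into (insert 0 {x. f x \<noteq> x})" for f :: "real \<Rightarrow> real"
  have e: "range (e f) = insert 0 {x. f x \<noteq> x}" if "f \<in> csupp_perms" for f
    unfolding e_def using that by (intro range_from_nat_into) (auto simp: csupp_perms_def)
  \<comment> \<open>\<open>s f\<close> lists the graph of \<open>f\<close> over its support and \<open>0\<close>: arguments at even places, values at odd ones.\<close>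
  define s where "s f m = (if even m then e f (m div 2) else f (e f (m div 2)))" for f m
  have f_eq: "f (s f (2 * n)) = s f (2 * n + 1)" for f n
    by (simp add: s_def)
  have s_range: "x \<in> range (\<lambda>n. s f (2 * n))" if "f \<in> csupp_perms" "f x \<noteq> x" for f x
    using e[OF that(1)] that(2) by (simp add: s_def)
  \<comment> \<open>A sequence of sets of naturals is packed into a single one through the pairing
    of naturals.\<close>
  define code where "code f = {m. snd (prod_decode m) \<in> b (s f (fst (prod_decode m)))}" for f
  have "inj_on code csupp_perms"
  proof (rule inj_onI)
    fix f g assume f: "f \<in> csupp_perms" and g: "g \<in> csupp_perms" and eq: "code f = code g"
    have "i \<in> b (s f n) \<longleftrightarrow> i \<in> b (s g n)" for i n
      using eq by (auto simp: code_def set_eq_iff dest: spec[of _ "prod_encode (n, i)"])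
    then have s: "s f = s g"
      using b by (auto simp: fun_eq_iff inj_def set_eq_iff)
    show "f = g"
    proof
      fix x
      \<comment> \<open>Listed points carry their values in the common list, and a point missing
        from it is fixed by both permutations.\<close>
      show "f x = g x"
      proof (cases "x \<in> range (\<lambda>n. s f (2 * n))")
        case True
        then show ?thesis using f_eq[of f] f_eq[of g] s by auto
      next
        case False
        then show ?thesis using s_range[OF f, of x] s_range[OF g, of x] s by metis
      qed
    qed
  qed
  then have "(csupp_perms :: (real \<Rightarrow> real) set) \<lesssim> (UNIV :: nat set set)"
    unfolding lepoll_def by blast
  then show "(csupp_perms :: (real \<Rightarrow> real) set) \<lesssim> (UNIV :: real set)"
    by (rule lepoll_trans[OF _ eqpoll_imp_lepoll[OF nat_sets_eqpoll_reals]])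
  have "inj (\<lambda>x :: real. Transposition.transpose x (x + 1))"
  proof (rule injI)
    fix x y :: real assume eq: "Transposition.transpose x (x + 1) = Transposition.transpose y (y + 1)"
    show "x = y"
      using fun_cong[OF eq, of x] fun_cong[OF eq, of y] by (auto simp: Transposition.transpose_def split: if_splits)
  qed
  then show "(UNIV :: real set) \<lesssim> (csupp_perms :: (real \<Rightarrow> real) set)"
    unfolding lepoll_def
    by (intro exI[of _ "\<lambda>x. Transposition.transpose x (x + 1)"])
      (auto intro: transpose_csupp_perms)
qed

text \<open>For \<open>y\<close> other than \<open>x\<close>, the transposition of
  \<open>r x\<close> and \<open>y\<close> fixes \<open>x\<close>, so conjugating with it turns the
  value \<open>r x\<close> into \<open>y\<close>. The map \<open>r\<close> is left general, since it
  will also be a group element followed by negation, which has uncountable support.\<close>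

lemma infinite_conjugates_at_point:
  assumes "r x \<noteq> x" and inf: "infinite (UNIV :: 'x set)"
  shows "infinite ((\<lambda>g. g (r (inv g x))) ` (csupp_perms :: ('x \<Rightarrow> 'x) set))"
proof -
  have "y \<in> (\<lambda>g. g (r (inv g x))) ` csupp_perms" if "y \<noteq> x" for y
  proof (rule image_eqI[OF _ transpose_csupp_perms])
    show "y = Transposition.transpose (r x) y (r (inv (Transposition.transpose (r x) y) x))"
      using assms(1) that by (simp add: transpose_apply_other)
  qed
  then have "UNIV - {x} \<subseteq> (\<lambda>g. g (r (inv g x))) ` csupp_perms" by blast
  then show ?thesis
    using inf by (meson finite.emptyI finite_insert finite_Diff2 finite_subset)
qed

lemma countable_support_Union:
  assumes "countable F" "F \<subseteq> csupp_perms"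
  shows "countable (\<Union>f\<in>F. {x. f x \<noteq> x})"
  using assms by (auto simp: csupp_perms_def)

text \<open>The witness is negation on the symmetric hull \<open>D\<close> of all supports and the
  identity off \<open>D\<close>. Symmetry of \<open>D\<close> makes it an involution; each
  \<open>f\<close> preserves \<open>D\<close> and is trivial outside, so the two conjugations agree
  on both pieces.\<close>

lemma csupp_perms_locally_conjugation:
  fixes F :: "(real \<Rightarrow> real) set"
  assumes F: "countable F" "F \<subseteq> csupp_perms"
  shows "\<exists>t\<in>csupp_perms. \<forall>f\<in>F. uminus \<circ> f \<circ> uminus = t \<circ> f \<circ> inv t"
proof -
  define C where "C = (\<Union>f\<in>F. {x. f x \<noteq> x})"
  define D where "D = C \<union> uminus ` C"
  have "countable D"
    using countable_support_Union[OF F] by (simp add: D_def C_def)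
  have D_minus: "- x \<in> D \<longleftrightarrow> x \<in> D" for x
    by (auto simp: D_def image_iff minus_equation_iff) (metis minus_minus)
  define t where "t x = (if x \<in> D then - x else x)" for x
  have tt: "t (t x) = x" for x by (simp add: t_def D_minus)
  have inv_t: "inv t = t" by (rule inv_equality) (simp_all add: tt)
  have "bij t" by (rule bij_betw_byWitness[where f' = t]) (simp_all add: tt)
  moreover have "countable {x. t x \<noteq> x}"
    by (rule countable_subset[OF _ \<open>countable D\<close>]) (auto simp: t_def)
  ultimately have "t \<in> csupp_perms" by (simp add: csupp_perms_def)
  moreover have "uminus \<circ> f \<circ> uminus = t \<circ> f \<circ> inv t" if f: "f \<in> F" for f
  proof
    fix x
    have "inj f" using f F(2) by (auto simp: csupp_perms_def bij_is_inj)
    have fix_off: "f y = y" if "y \<notin> D" for y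
      using that f by (auto simp: D_def C_def)
    have f_D: "f y \<in> D" if "y \<in> D" for y
    proof (rule ccontr)
      assume "f y \<notin> D"
      then have "f (f y) = f y" by (rule fix_off)
      then show False using \<open>inj f\<close> \<open>f y \<notin> D\<close> that by (simp add: inj_eq)
    qed
    show "(uminus \<circ> f \<circ> uminus) x = (t \<circ> f \<circ> inv t) x"
      by (cases "x \<in> D") (simp_all add: inv_t t_def D_minus f_D fix_off)
  qed
  ultimately show ?thesis by blast
qed

text \<open>Three points remain outside the countable union of supports, and permutations of these
  commute with \<open>F\<close>. Two distinct transpositions of three points have a 3-cycle as
  commutator, which commutes with neither.\<close>

lemma csupp_perms_nonabelian_centralizer:
  fixes F :: "('x \<Rightarrow> 'x) set"
  assumes unc: "uncountable (UNIV :: 'x set)" and F: "countable F" "F \<subseteq> csupp_perms"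
  shows "\<exists>g\<in>csupp_perms. \<exists>h\<in>csupp_perms. (\<forall>f\<in>F. g \<circ> f = f \<circ> g \<and> h \<circ> f = f \<circ> h) \<and>
    g \<circ> (g \<circ> h \<circ> inv g \<circ> inv h) \<noteq> g \<circ> h \<circ> inv g \<circ> inv h \<circ> g"
proof -
  define C where "C = (\<Union>f\<in>F. {x. f x \<noteq> x})"
  have "infinite (UNIV - C)"
    using countable_support_Union[OF F] unc
    by (metis C_def uncountable_infinite uncountable_minus_countable)
  then obtain T where "T \<subseteq> UNIV - C" "card T = 3"
    using infinite_arbitrarily_large by metis
  then obtain a b c where abc: "a \<notin> C" "b \<notin> C" "c \<notin> C" "a \<noteq> b" "b \<noteq> c" "a \<noteq> c"
    by (auto simp: card_3_iff)
  have comm: "Transposition.transpose u v \<circ> f = f \<circ> Transposition.transpose u v"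
    if "f \<in> F" "u \<notin> C" "v \<notin> C" for f u v
  proof -
    have fix_uv: "f u = u" "f v = v" using that by (auto simp: C_def)
    have "inj f" using that F(2) by (auto simp: csupp_perms_def bij_is_inj)
    then have "f x = u \<longleftrightarrow> x = u" "f x = v \<longleftrightarrow> x = v" for x
      using fix_uv by (metis injD)+
    then show ?thesis
      by (simp add: fun_eq_iff Transposition.transpose_def fix_uv)
  qed
  let ?g = "Transposition.transpose a b" and ?h = "Transposition.transpose b c"
  have "(?g \<circ> (?g \<circ> ?h \<circ> inv ?g \<circ> inv ?h)) a \<noteq> (?g \<circ> ?h \<circ> inv ?g \<circ> inv ?h \<circ> ?g) a"
    using abc by (simp add: Transposition.transpose_def)
  then have "?g \<circ> (?g \<circ> ?h \<circ> inv ?g \<circ> inv ?h) \<noteq> ?g \<circ> ?h \<circ> inv ?g \<circ> inv ?h \<circ> ?g"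
    by (rule contrapos_nn) (rule fun_cong[where x = a])
  then show ?thesis
    by (intro bexI[of _ ?g] bexI[of _ ?h] conjI ballI comm transpose_csupp_perms abc)
qed

section \<open>Transport of the permutation group to the reals and conclusion\<close>

theorem theorem2p5:
  shows "\<exists>(M :: (real ell2 \<Rightarrow>\<^sub>L real ell2) set) \<theta>.
    type_II1_factor M \<and> star_automorphism M \<theta> \<and> locally_inner M \<theta> \<and> \<not> inner_automorphism M \<theta>"
proof -
  obtain \<phi> :: "real \<Rightarrow> real \<Rightarrow> real" where \<phi>: "bij_betw \<phi> UNIV csupp_perms"
    using csupp_perms_eqpoll_real eqpoll_sym unfolding eqpoll_def by blast
  have \<phi>_in: "\<phi> x \<in> csupp_perms" for x
    using \<phi> by (auto simp: bij_betw_def)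
  define \<psi> where "\<psi> = inv_into UNIV \<phi>"
  have \<phi>\<psi>: "\<phi> (\<psi> f) = f" if "f \<in> csupp_perms" for f
    using \<phi> that by (simp add: \<psi>_def bij_betw_inv_into_right)
  have \<phi>_eq: "\<phi> x = \<phi> y \<longleftrightarrow> x = y" for x y
    using \<phi> by (auto simp: bij_betw_def inj_eq)
  have bij_\<phi>: "bij (\<phi> x)" for x
    using \<phi>_in[of x] by (simp add: csupp_perms_def)
  \<comment> \<open>The group structure is transported to the reals, since the Hilbert space must be \<open>real ell2\<close>.\<close>
  define mult where "mult x y = \<psi> (\<phi> x \<circ> \<phi> y)" for x y
  define inverse where "inverse x = \<psi> (inv (\<phi> x))" for x
  define one where "one = \<psi> id"
  have \<phi>_mult: "\<phi> (mult x y) = \<phi> x \<circ> \<phi> y" for x y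
    by (simp add: mult_def \<phi>\<psi> comp_csupp_perms \<phi>_in)
  have \<phi>_inverse: "\<phi> (inverse x) = inv (\<phi> x)" for x
    by (simp add: inverse_def \<phi>\<psi> inv_csupp_perms \<phi>_in)
  have \<phi>_one: "\<phi> one = id"
    by (simp add: one_def \<phi>\<psi> id_csupp_perms)
  interpret G: group mult one inverse
    by unfold_locales (simp_all add: \<phi>_mult \<phi>_inverse \<phi>_one comp_assoc bij_is_inj[OF bij_\<phi>] flip: \<phi>_eq)
  define \<alpha> where "\<alpha> x = \<psi> (uminus \<circ> \<phi> x \<circ> uminus)" for x
  have "uminus \<circ> \<phi> x \<circ> uminus \<in> csupp_perms" for x
  proof -
    have "countable (uminus ` {y. \<phi> x y \<noteq> y})"
      using \<phi>_in[of x] by (simp add: csupp_perms_def)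
    moreover have "{y. (uminus \<circ> \<phi> x \<circ> uminus) y \<noteq> y} \<subseteq> uminus ` {y. \<phi> x y \<noteq> y}"
      by (auto simp: image_iff) (metis minus_minus)
    ultimately have "countable {y. (uminus \<circ> \<phi> x \<circ> uminus) y \<noteq> y}"
      by (rule countable_subset[rotated])
    then show ?thesis
      using bij_\<phi>[of x] by (simp add: csupp_perms_def bij_comp bij_uminus del: o_apply)
  qed
  then have \<phi>_\<alpha>: "\<phi> (\<alpha> x) = uminus \<circ> \<phi> x \<circ> uminus" for x
    by (simp add: \<alpha>_def \<phi>\<psi>)
  have \<alpha>\<alpha>: "\<alpha> (\<alpha> x) = x" for x
    by (simp add: fun_eq_iff \<phi>_\<alpha> flip: \<phi>_eq)
  have bij_\<alpha>: "bij \<alpha>"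
    by (rule bij_betw_byWitness[where f' = \<alpha>]) (simp_all add: \<alpha>\<alpha>)
  have hom_\<alpha>: "\<alpha> (mult x y) = mult (\<alpha> x) (\<alpha> y)" for x y
    by (simp add: fun_eq_iff \<phi>_\<alpha> \<phi>_mult flip: \<phi>_eq)
  \<comment> \<open>Conjugacy classes are shown infinite through their images under evaluation at
    one point; this rewrites such images over the permutations themselves.\<close>
  have range_\<phi>: "range (\<lambda>g. F (\<phi> g)) = F ` csupp_perms" for F :: "(real \<Rightarrow> real) \<Rightarrow> real"
    using \<phi> by (metis bij_betw_def image_image)
  have icc: "infinite (range (\<lambda>g. mult (mult g s) (inverse g)))" if s: "s \<noteq> one" for s
  proof -
    obtain x where "\<phi> s x \<noteq> x"
      using s by (metis \<phi>_eq \<phi>_one eq_id_iff)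
    from infinite_conjugates_at_point[where r = \<open>\<phi> s\<close>, OF this infinite_UNIV_char_0]
    have "infinite (range (\<lambda>g. \<phi> g (\<phi> s (inv (\<phi> g) x))))"
      by (simp add: range_\<phi>[of "\<lambda>g. g (\<phi> s (inv g x))"])
    also have "range (\<lambda>g. \<phi> g (\<phi> s (inv (\<phi> g) x))) =
        (\<lambda>y. \<phi> y x) ` range (\<lambda>g. mult (mult g s) (inverse g))"
      by (simp add: image_image \<phi>_mult \<phi>_inverse)
    finally show ?thesis by blast
  qed
  have twisted: "infinite (range (\<lambda>g. mult (mult (\<alpha> g) s) (inverse g)))" for s
  proof -
    \<comment> \<open>A nonzero fixed point of \<open>\<phi> s\<close> witnesses that
      \<open>\<phi> s\<close> differs from negation; it exists because the support is
      countable.\<close>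
    have "uncountable (UNIV - insert 0 {x. \<phi> s x \<noteq> x})"
      using \<phi>_in[of s] by (intro uncountable_minus_countable uncountable_UNIV_real)
        (simp add: csupp_perms_def)
    then have "UNIV - insert 0 {x. \<phi> s x \<noteq> x} \<noteq> {}"
      by (metis countable_empty)
    then obtain x where "x \<noteq> 0" "\<phi> s x = x" by blast
    then have "- \<phi> s x \<noteq> x" by simp
    from infinite_conjugates_at_point[where r = \<open>\<lambda>y. - \<phi> s y\<close>, OF this infinite_UNIV_char_0]
    have "infinite (range (\<lambda>g. \<phi> g (- \<phi> s (inv (\<phi> g) x))))"
      by (simp add: range_\<phi>[of "\<lambda>g. g (- \<phi> s (inv g x))"])
    \<comment> \<open>Negating the value at \<open>x\<close> cancels the outer negation in \<alpha>,
      while the inner one joins \<open>\<phi> s\<close>: twisted conjugation of \<open>s\<close>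
      becomes ordinary conjugation of its negative.\<close>
    also have "range (\<lambda>g. \<phi> g (- \<phi> s (inv (\<phi> g) x))) =
        (\<lambda>y. - \<phi> y x) ` range (\<lambda>g. mult (mult (\<alpha> g) s) (inverse g))"
      by (simp add: image_image \<phi>_mult \<phi>_inverse \<phi>_\<alpha>)
    finally show ?thesis by blast
  qed
  have local: "\<exists>t. \<forall>s\<in>S. \<alpha> s = mult (mult t s) (inverse t)" if "countable S" for S
  proof -
    have "countable (\<phi> ` S)" "\<phi> ` S \<subseteq> csupp_perms"
      using that \<phi>_in by auto
    from csupp_perms_locally_conjugation[OF this]
    obtain t where "t \<in> csupp_perms" "\<forall>f\<in>\<phi> ` S. uminus \<circ> f \<circ> uminus = t \<circ> f \<circ> inv t" by (elim bexE)
    then have "\<forall>s\<in>S. \<alpha> s = mult (mult (\<psi> t) s) (inverse (\<psi> t))"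
      by (simp add: \<phi>_\<alpha> \<phi>_mult \<phi>_inverse \<phi>\<psi> flip: \<phi>_eq)
    then show ?thesis by blast
  qed
  have centralizer: "\<exists>g h. (\<forall>s\<in>S. mult g s = mult s g \<and> mult h s = mult s h) \<and>
      mult g (mult (mult (mult g h) (inverse g)) (inverse h)) \<noteq>
      mult (mult (mult (mult g h) (inverse g)) (inverse h)) g" if "countable S" for S
  proof -
    have "countable (\<phi> ` S)" "\<phi> ` S \<subseteq> csupp_perms"
      using that \<phi>_in by auto
    from csupp_perms_nonabelian_centralizer[OF uncountable_UNIV_real this]
    obtain g h where "g \<in> csupp_perms" "h \<in> csupp_perms"
      and "\<forall>f\<in>\<phi> ` S. g \<circ> f = f \<circ> g \<and> h \<circ> f = f \<circ> h"
      and "g \<circ> (g \<circ> h \<circ> inv g \<circ> inv h) \<noteq> g \<circ> h \<circ> inv g \<circ> inv h \<circ> g"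
      by (elim bexE conjE)
    then show ?thesis
      by (intro exI[of _ "\<psi> g"] exI[of _ "\<psi> h"])
        (simp add: \<phi>_mult \<phi>_inverse \<phi>\<psi> flip: \<phi>_eq)
  qed
  have "type_II1_factor G.group_vn"
    unfolding type_II1_factor_def
    using G.factor_group_vn[OF icc] G.finite_projection_id
      G.abelian_projection_group_vn_eq_0[OF centralizer] by blast
  then show ?thesis
    using G.star_automorphism_induced[OF bij_\<alpha> hom_\<alpha>] G.locally_inner_induced[OF bij_\<alpha> hom_\<alpha> local]
      G.not_inner_induced[OF bij_\<alpha> hom_\<alpha> twisted] by blast
qed

end
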